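(* Let $A_1,\dots,A_m$ be normal $n\times n$ complex matrices, let $Z_1,\dots,Z_m$ be $n\times n$ matrices with $Z_i^*Z_i\ge I$ for each $i$, and let $f:[0,\infty)\to[0,\infty)$ be concave. Then for every symmetric norm, $$\Big\|\, f\Big(\Big|\sum_{i=1}^m Z_i^*A_iZ_i\Big|\Big)\,\Big\| \le \Big\|\, \sum_{i=1}^m Z_i^*f(|A_i|)Z_i\,\Big\|.$$
   Context: For a matrix $X$, $|X|=(X^*X)^{1/2}$, and $f(|X|)$ is defined by the functional calculus. $Z^*Z\ge I$ is in the positive semi-definite order. A symmetric (unitarily invariant) norm is a norm on $n\times n$ matrices satisfying $\|UXV\|=\|X\|$ for all matrices $X$ and all unitaries $U,V$. *)

theory Defs
  imports "HOL-Analysis.Analysis" "Jordan_Normal_Form.Schur_Decomposition"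
begin

definition unitary_mat :: "nat \<Rightarrow> complex mat \<Rightarrow> bool" where
  "unitary_mat n U \<longleftrightarrow> U \<in> carrier_mat n n \<and> mat_adjoint U * U = 1\<^sub>m n"

definition normal_mat :: "nat \<Rightarrow> complex mat \<Rightarrow> bool" where
  "normal_mat n A \<longleftrightarrow> A \<in> carrier_mat n n \<and> A * mat_adjoint A = mat_adjoint A * A"

definition hermitian_mat :: "nat \<Rightarrow> complex mat \<Rightarrow> bool" where
  "hermitian_mat n H \<longleftrightarrow> H \<in> carrier_mat n n \<and> mat_adjoint H = H"

definition psd_mat :: "nat \<Rightarrow> complex mat \<Rightarrow> bool" where
  "psd_mat n H \<longleftrightarrow> hermitian_mat n H \<and>
     (\<forall>v \<in> carrier_vec n. 0 \<le> Re (conjugate v \<bullet> (H *\<^sub>v v)))"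

definition loewner_le :: "nat \<Rightarrow> complex mat \<Rightarrow> complex mat \<Rightarrow> bool" where
  "loewner_le n X Y \<longleftrightarrow> X \<in> carrier_mat n n \<and> Y \<in> carrier_mat n n \<and> psd_mat n (Y - X)"

definition real_diag :: "nat \<Rightarrow> (nat \<Rightarrow> real) \<Rightarrow> complex mat" where
  "real_diag n d = mat n n (\<lambda>(i,j). if i = j then complex_of_real (d i) else 0)"

definition mat_fun :: "nat \<Rightarrow> (real \<Rightarrow> real) \<Rightarrow> complex mat \<Rightarrow> complex mat" where
  "mat_fun n f H = (THE B. \<exists>U d. unitary_mat n U \<and> H = U * real_diag n d * mat_adjoint U
                         \<and> B = U * real_diag n (\<lambda>i. f (d i)) * mat_adjoint U)"

definition mat_abs :: "nat \<Rightarrow> complex mat \<Rightarrow> complex mat" where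
  "mat_abs n X = mat_fun n sqrt (mat_adjoint X * X)"

definition symmetric_norm :: "nat \<Rightarrow> (complex mat \<Rightarrow> real) \<Rightarrow> bool" where
  "symmetric_norm n N \<longleftrightarrow>
     (\<forall>X \<in> carrier_mat n n. 0 \<le> N X \<and> (N X = 0 \<longleftrightarrow> X = 0\<^sub>m n n)) \<and>
     (\<forall>X \<in> carrier_mat n n. \<forall>c. N (c \<cdot>\<^sub>m X) = cmod c * N X) \<and>
     (\<forall>X \<in> carrier_mat n n. \<forall>Y \<in> carrier_mat n n. N (X + Y) \<le> N X + N Y) \<and>
     (\<forall>X \<in> carrier_mat n n. \<forall>U V. unitary_mat n U \<longrightarrow> unitary_mat n V \<longrightarrow> N (U * X * V) = N X)"

fun mat_sum :: "nat \<Rightarrow> (nat \<Rightarrow> complex mat) \<Rightarrow> nat \<Rightarrow> complex mat" where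
  "mat_sum n F 0 = 0\<^sub>m n n"
| "mat_sum n F (Suc k) = mat_sum n F k + F k"

end

theory Submission
  imports Defs
begin

text \<open>
  Write \<open>A\<^sub>i = \<Sum> \<alpha>\<^sub>j a\<^sub>j a\<^sub>j\<^sup>*\<close> with orthonormal eigenvectors and collect all vectors \<open>b\<^sub>j = Z\<^sub>i\<^sup>* a\<^sub>j\<close>; as
  \<open>Z\<^sub>i\<close> is expansive, \<open>|b\<^sub>j| \<ge> 1\<close>. One has to compare the singular values of \<open>X = \<Sum> \<alpha>\<^sub>j b\<^sub>j b\<^sub>j\<^sup>*\<close> with
  the eigenvalues of \<open>C = \<Sum> f(|\<alpha>\<^sub>j|) b\<^sub>j b\<^sub>j\<^sup>*\<close>, and \<open>f(0) = 0\<close> may be assumed.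
  Let \<open>P\<close> and \<open>Q\<close> have the columns \<open>|\<alpha>\<^sub>j|\<^sup>1\<^sup>/\<^sup>2 b\<^sub>j\<close> and \<open>\<theta>\<^sub>j |\<alpha>\<^sub>j|\<^sup>1\<^sup>/\<^sup>2 b\<^sub>j\<close>, where
  \<open>\<alpha>\<^sub>j = \<theta>\<^sub>j |\<alpha>\<^sub>j|\<close>. Then \<open>X = Q P\<^sup>*\<close>, so the singular values of \<open>X\<close> are bounded one by one by the
  eigenvalues \<open>\<mu>\<^sub>i\<close> of \<open>G = (P\<^sup>* P + Q\<^sup>* Q) / 2\<close>. The diagonal of \<open>G\<close> dominates \<open>|\<alpha>\<^sub>j|\<close>; expressed in
  an eigenbasis of \<open>G\<close>, this turns the estimate of \<open>\<Sum>\<^sub>i\<^sub><\<^sub>k f(\<mu>\<^sub>i)\<close> into a scalar inequality for a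
  doubly stochastic matrix, which follows from Jensen's inequality. Its right-hand side is at most
  the sum of the \<open>k\<close> largest eigenvalues of \<open>h\<^sup>1\<^sup>/\<^sup>2 G h\<^sup>1\<^sup>/\<^sup>2\<close> with \<open>h = diag (f(|\<alpha>\<^sub>j|) / |\<alpha>\<^sub>j|)\<close>, which is the
  average of two Gram matrices having the nonzero spectrum of \<open>C\<close>. The resulting weak majorization
  passes to every symmetric norm.
\<close>

section \<open>Orthonormal families\<close>

text \<open>Vectors are functions on \<open>nat\<close> of which only the first \<open>d\<close> entries are relevant.\<close>

definition cip :: "nat \<Rightarrow> (nat \<Rightarrow> complex) \<Rightarrow> (nat \<Rightarrow> complex) \<Rightarrow> complex" where
  "cip d x y = (\<Sum>i<d. cnj (x i) * y i)"

definition sqn :: "nat \<Rightarrow> (nat \<Rightarrow> complex) \<Rightarrow> real" where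
  "sqn d x = (\<Sum>i<d. (cmod (x i))\<^sup>2)"

definition orthonormal :: "nat \<Rightarrow> nat set \<Rightarrow> (nat \<Rightarrow> nat \<Rightarrow> complex) \<Rightarrow> bool" where
  "orthonormal d I e \<longleftrightarrow> (\<forall>a\<in>I. \<forall>b\<in>I. cip d (e a) (e b) = (if a = b then 1 else 0))"

text \<open>\<open>l\<close> is the number of columns. The number of rows does not occur, since the
  result is a function of which any entry can be asked for; \<open>adj\<close> likewise carries no
  dimension.\<close>

definition mv :: "nat \<Rightarrow> (nat \<Rightarrow> nat \<Rightarrow> complex) \<Rightarrow> (nat \<Rightarrow> complex) \<Rightarrow> nat \<Rightarrow> complex" where
  "mv l B y = (\<lambda>r. \<Sum>j<l. B r j * y j)"

definition adj :: "(nat \<Rightarrow> nat \<Rightarrow> complex) \<Rightarrow> nat \<Rightarrow> nat \<Rightarrow> complex" where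
  "adj B = (\<lambda>j r. cnj (B r j))"

lemma adj_adj [simp]: "adj (adj B) = B"
  by (simp add: adj_def)

lemma cnj_mult_self: "cnj z * z = of_real ((cmod z)\<^sup>2)" "z * cnj z = of_real ((cmod z)\<^sup>2)"
  by (simp_all only: complex_norm_square mult.commute)

lemma cip_self: "cip d x x = of_real (sqn d x)"
  by (simp only: cip_def sqn_def cnj_mult_self of_real_sum)

lemma Re_cip_self [simp]: "Re (cip d x x) = sqn d x"
  by (simp add: cip_self)

lemma sqn_nonneg [simp]: "0 \<le> sqn d x"
  by (simp add: sqn_def sum_nonneg)

lemma cnj_cip: "cnj (cip d x y) = cip d y x"
  by (simp add: cip_def mult.commute)

lemma cmod_cip_commute: "cmod (cip d x y) = cmod (cip d y x)"
  by (metis cnj_cip complex_mod_cnj)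

lemma cip_cong:
  assumes "\<And>i. i < d \<Longrightarrow> x i = x' i" "\<And>i. i < d \<Longrightarrow> y i = y' i"
  shows "cip d x y = cip d x' y'"
  using assms by (simp add: cip_def)

lemma sqn_cong: "(\<And>i. i < d \<Longrightarrow> x i = x' i) \<Longrightarrow> sqn d x = sqn d x'"
  by (simp add: sqn_def)

lemma cip_add_right: "cip d x (\<lambda>i. y i + z i) = cip d x y + cip d x z"
  by (simp add: cip_def algebra_simps sum.distrib)

lemma cip_add_left: "cip d (\<lambda>i. y i + z i) x = cip d y x + cip d z x"
  by (simp add: cip_def algebra_simps sum.distrib)

lemma cip_diff_right: "cip d x (\<lambda>i. y i - z i) = cip d x y - cip d x z"
  by (simp add: cip_def algebra_simps sum_subtractf)

lemma cip_diff_left: "cip d (\<lambda>i. y i - z i) x = cip d y x - cip d z x"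
  by (simp add: cip_def algebra_simps sum_subtractf)

lemma cip_scale_right: "cip d x (\<lambda>i. c * y i) = c * cip d x y"
  by (simp add: cip_def algebra_simps sum_distrib_left)

lemma cip_scale_left: "cip d (\<lambda>i. c * y i) x = cnj c * cip d y x"
  by (simp add: cip_def algebra_simps sum_distrib_left)

lemma cip_sum_right: "cip d x (\<lambda>i. \<Sum>a\<in>I. c a * e a i) = (\<Sum>a\<in>I. c a * cip d x (e a))"
  by (simp add: cip_def sum_distrib_left) (subst sum.swap, simp add: algebra_simps)

lemma cip_sum_left: "cip d (\<lambda>i. \<Sum>a\<in>I. c a * e a i) x = (\<Sum>a\<in>I. cnj (c a) * cip d (e a) x)"
  by (simp add: cip_def sum_distrib_left sum_distrib_right)
    (subst sum.swap, simp add: algebra_simps)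

lemma sqn_scale: "sqn d (\<lambda>i. c * x i) = (cmod c)\<^sup>2 * sqn d x"
  by (simp add: sqn_def norm_mult power_mult_distrib sum_distrib_left)

lemma sqn_zero_iff: "sqn d x = 0 \<longleftrightarrow> (\<forall>i<d. x i = 0)"
  by (auto simp: sqn_def sum_nonneg_eq_0_iff)

lemma cip_mv_right: "cip d x (mv l B y) = cip l (mv d (adj B) x) y"
  by (simp add: cip_def mv_def adj_def sum_distrib_left sum_distrib_right)
    (subst sum.swap, simp add: algebra_simps)

lemma cip_mv_left: "cip d (mv l B y) x = cip l y (mv d (adj B) x)"
  using cip_mv_right[of l y d "adj B" x] by simp

section \<open>Expansions in orthonormal families\<close>

lemma orthonormalD:
  "orthonormal d I e \<Longrightarrow> a \<in> I \<Longrightarrow> b \<in> I \<Longrightarrow> cip d (e a) (e b) = (if a = b then 1 else 0)"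
  by (simp add: orthonormal_def)

lemma orthonormal_sqn: "orthonormal d I e \<Longrightarrow> a \<in> I \<Longrightarrow> sqn d (e a) = 1"
  using orthonormalD[of d I e a a] by (simp add: cip_self)

lemma orthonormal_subset: "orthonormal d I e \<Longrightarrow> J \<subseteq> I \<Longrightarrow> orthonormal d J e"
  unfolding orthonormal_def by blast

lemma orthonormal_cip_sum:
  assumes "orthonormal d I e" "finite I" "a \<in> I"
  shows "cip d (e a) (\<lambda>i. \<Sum>b\<in>I. c b * e b i) = c a"
proof -
  have "cip d (e a) (\<lambda>i. \<Sum>b\<in>I. c b * e b i) = (\<Sum>b\<in>I. c b * (if a = b then 1 else 0))"
    unfolding cip_sum_right using assms by (intro sum.cong) (auto simp: orthonormalD)
  also have "\<dots> = c a"
    using assms by (simp add: if_distrib[of "\<lambda>z. _ * z"] cong: if_cong)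
  finally show ?thesis .
qed

lemma orthonormal_sqn_sum:
  assumes "orthonormal d I e" "finite I"
  shows "sqn d (\<lambda>i. \<Sum>a\<in>I. c a * e a i) = (\<Sum>a\<in>I. (cmod (c a))\<^sup>2)"
proof -
  have "complex_of_real (sqn d (\<lambda>i. \<Sum>a\<in>I. c a * e a i)) = (\<Sum>a\<in>I. cnj (c a) * c a)"
    unfolding cip_self[symmetric] cip_sum_left
    by (intro sum.cong refl) (subst orthonormal_cip_sum[OF assms], auto)
  also have "\<dots> = of_real (\<Sum>a\<in>I. (cmod (c a))\<^sup>2)"
    by (simp only: cnj_mult_self of_real_sum)
  finally show ?thesis
    using of_real_eq_iff by blast
qed

text \<open>Pythagoras for the projection onto the span of the family. Nonnegativity of the left
  side gives Bessel's inequality, and its vanishing for a full basis gives Parseval's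
  identity.\<close>

lemma sqn_residual:
  assumes "orthonormal d I e" "finite I"
  shows "sqn d (\<lambda>i. y i - (\<Sum>a\<in>I. cip d (e a) y * e a i)) = sqn d y - (\<Sum>a\<in>I. (cmod (cip d (e a) y))\<^sup>2)"
proof -
  let ?p = "\<lambda>i. \<Sum>a\<in>I. cip d (e a) y * e a i"
  have yp: "cip d ?p y = of_real (\<Sum>a\<in>I. (cmod (cip d (e a) y))\<^sup>2)"
    unfolding cip_sum_left by (simp only: cnj_mult_self of_real_sum)
  have py: "cip d y ?p = of_real (\<Sum>a\<in>I. (cmod (cip d (e a) y))\<^sup>2)"
    using arg_cong[OF yp, of cnj] unfolding cnj_cip by simp
  have "complex_of_real (sqn d (\<lambda>i. y i - ?p i)) = of_real (sqn d y - (\<Sum>a\<in>I. (cmod (cip d (e a) y))\<^sup>2))"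
    unfolding cip_self[symmetric] cip_diff_left cip_diff_right yp py
    unfolding cip_self orthonormal_sqn_sum[OF assms] by simp
  then show ?thesis
    using of_real_eq_iff by blast
qed

lemma bessel:
  assumes "orthonormal d I e" "finite I"
  shows "(\<Sum>a\<in>I. (cmod (cip d (e a) y))\<^sup>2) \<le> sqn d y"
  using sqn_residual[OF assms, of y] sqn_nonneg[of d "\<lambda>i. y i - (\<Sum>a\<in>I. cip d (e a) y * e a i)"]
  by linarith

text \<open>Bessel's inequality for the one-element family that consists of the normalized
  \<open>x\<close>.\<close>

lemma cip_cauchy_schwarz: "(cmod (cip d x y))\<^sup>2 \<le> sqn d x * sqn d y"
proof (cases "sqn d x = 0")
  case True
  then have "cip d x y = 0"
    by (simp add: sqn_zero_iff cip_def)
  then show ?thesis using True by simp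
next
  case False
  then have pos: "sqn d x > 0"
    using sqn_nonneg[of d x] by linarith
  define c where "c = complex_of_real (1 / sqrt (sqn d x))"
  have c2: "(cmod c)\<^sup>2 = 1 / sqn d x"
    using pos by (simp add: c_def norm_divide power_divide)
  have "orthonormal d {0} (\<lambda>_ i. c * x i)"
    using pos by (simp add: orthonormal_def cip_self sqn_scale c2)
  from bessel[OF this, of y] have "(cmod c)\<^sup>2 * (cmod (cip d x y))\<^sup>2 \<le> sqn d y"
    by (simp add: cip_scale_left norm_mult power_mult_distrib)
  then show ?thesis
    using pos by (simp add: c2 field_simps)
qed

text \<open>A left inverse of a square matrix is also a right inverse, so orthonormal columns force
  orthonormal rows.\<close>

lemma orthonormal_complete:
  assumes "orthonormal d {..<d} e" "r < d" "s < d"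
  shows "(\<Sum>a<d. e a r * cnj (e a s)) = (if r = s then 1 else 0)"
proof -
  define U where "U = mat d d (\<lambda>(r,a). e a r)"
  define V where "V = mat d d (\<lambda>(a,r). cnj (e a r))"
  have c: "U \<in> carrier_mat d d" "V \<in> carrier_mat d d"
    by (auto simp: U_def V_def)
  have "V * U = 1\<^sub>m d"
  proof (rule eq_matI)
    fix i j assume "i < dim_row (1\<^sub>m d :: complex mat)" "j < dim_col (1\<^sub>m d :: complex mat)"
    then show "(V * U) $$ (i,j) = 1\<^sub>m d $$ (i,j)"
      using orthonormalD[OF assms(1), of i j]
      by (auto simp: U_def V_def scalar_prod_def cip_def atLeast0LessThan)
  qed (use c in auto)
  then have "U * V = 1\<^sub>m d"
    using mat_mult_left_right_inverse c by blast
  then have "(U * V) $$ (r,s) = 1\<^sub>m d $$ (r,s)" by simp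
  then show ?thesis
    using assms by (auto simp: U_def V_def scalar_prod_def atLeast0LessThan)
qed

lemma orthonormal_expand:
  assumes "orthonormal d {..<d} e" "r < d"
  shows "(\<Sum>a<d. cip d (e a) y * e a r) = y r"
proof -
  have "(\<Sum>a<d. cip d (e a) y * e a r) = (\<Sum>s<d. (\<Sum>a<d. e a r * cnj (e a s)) * y s)"
    unfolding cip_def sum_distrib_right by (subst sum.swap) (simp add: algebra_simps)
  also have "\<dots> = (\<Sum>s<d. (if r = s then 1 else 0) * y s)"
    using orthonormal_complete[OF assms(1,2)] by (intro sum.cong) auto
  also have "\<dots> = y r"
    using assms(2) by (simp add: if_distrib[of "\<lambda>c. c * _"] cong: if_cong)
  finally show ?thesis .
qed

lemma parseval:
  assumes "orthonormal d {..<d} e"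
  shows "(\<Sum>a<d. (cmod (cip d (e a) y))\<^sup>2) = sqn d y"
proof -
  have "sqn d (\<lambda>i. y i - (\<Sum>a<d. cip d (e a) y * e a i)) = 0"
    unfolding sqn_zero_iff using orthonormal_expand[OF assms] by simp
  then show ?thesis
    using sqn_residual[OF assms, of y] by simp
qed

section \<open>The spectral theorem\<close>

text \<open>This dimension count serves three ends: enlarging orthonormal families, finding a test
  vector orthogonal to leading eigenvectors, and solving an equation with an expansive
  matrix.\<close>

lemma homogeneous_system_solution:
  fixes M :: "nat \<Rightarrow> nat \<Rightarrow> complex"
  assumes "k < d"
  shows "\<exists>c. (\<exists>i<d. c i \<noteq> 0) \<and> (\<forall>a<k. (\<Sum>i<d. M a i * c i) = 0)"
proof -
  \<comment> \<open>The system is padded with zero rows to a square matrix, whose determinant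
    vanishes because row \<open>k\<close> is zero.\<close>
  define Q where "Q = mat d d (\<lambda>(a,i). if a < k then M a i else 0)"
  have Q: "Q \<in> carrier_mat d d" by (simp add: Q_def)
  have "mat\<^sub>r d d (\<lambda>i. if i = k then 0\<^sub>v d else row Q i) = Q"
    using assms by (intro eq_matI) (auto simp: Q_def)
  moreover have "det (mat\<^sub>r d d (\<lambda>i. if i = k then 0\<^sub>v d else row Q i)) = 0"
    by (rule det_row_0[OF assms]) (auto simp: Q_def)
  ultimately have "det Q = 0" by simp
  then obtain v where v: "v \<in> carrier_vec d" "v \<noteq> 0\<^sub>v d" "Q *\<^sub>v v = 0\<^sub>v d"
    using det_0_iff_vec_prod_zero_field[OF Q] by blast
  have "\<exists>i<d. v $ i \<noteq> 0"
    using v(1,2) by (metis carrier_vecD eq_vecI index_zero_vec)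
  moreover have "(\<Sum>i<d. M a i * v $ i) = 0" if "a < k" for a
  proof -
    have "(Q *\<^sub>v v) $ a = 0"
      using v(3) that assms by simp
    then show ?thesis
      using that assms v(1) by (simp add: Q_def scalar_prod_def atLeast0LessThan)
  qed
  ultimately show ?thesis by blast
qed

text \<open>The characteristic polynomial is nonconstant for \<open>0 < d\<close>, so it has a
  complex root; an eigenvector for it is normalized.\<close>

lemma unit_eigenvector_exists:
  fixes A :: "nat \<Rightarrow> nat \<Rightarrow> complex"
  assumes "0 < d"
  shows "\<exists>\<mu> c. sqn d c = 1 \<and> (\<forall>r<d. (\<Sum>s<d. A r s * c s) = \<mu> * c r)"
proof -
  define Q where "Q = mat d d (\<lambda>(r,s). A r s)"
  have Q: "Q \<in> carrier_mat d d" by (simp add: Q_def)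
  have "degree (char_poly Q) = d"
    using degree_monic_char_poly[OF Q] by simp
  then have "\<not> constant (poly (char_poly Q))"
    using assms by (simp add: constant_degree)
  then obtain \<mu> where "poly (char_poly Q) \<mu> = 0"
    using fundamental_theorem_of_algebra by blast
  then have "eigenvalue Q \<mu>"
    using eigenvalue_root_char_poly[OF Q] by simp
  then obtain v where v: "v \<in> carrier_vec d" "v \<noteq> 0\<^sub>v d" "Q *\<^sub>v v = \<mu> \<cdot>\<^sub>v v"
    using Q unfolding eigenvalue_def eigenvector_def by auto
  let ?v = "\<lambda>i. v $ i"
  have ev: "(\<Sum>s<d. A r s * v $ s) = \<mu> * v $ r" if "r < d" for r
  proof -
    have "(Q *\<^sub>v v) $ r = \<mu> * v $ r"
      using v that by simp
    then show ?thesis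
      using that v(1) by (simp add: Q_def scalar_prod_def atLeast0LessThan)
  qed
  have "\<exists>i<d. v $ i \<noteq> 0"
    using v(1,2) by (metis carrier_vecD eq_vecI index_zero_vec)
  then have "sqn d ?v \<noteq> 0"
    by (auto simp: sqn_zero_iff)
  then have pos: "sqn d ?v > 0"
    using sqn_nonneg[of d ?v] by linarith
  define c where "c = (\<lambda>i. complex_of_real (1 / sqrt (sqn d ?v)) * v $ i)"
  have "sqn d c = 1"
    unfolding c_def sqn_scale using pos by (simp add: norm_divide power_divide)
  moreover have "(\<Sum>s<d. A r s * c s) = \<mu> * c r" if "r < d" for r
    using arg_cong[OF ev[OF that], of "\<lambda>z. complex_of_real (1 / sqrt (sqn d ?v)) * z"]
    unfolding c_def by (simp add: sum_distrib_left algebra_simps)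
  ultimately show ?thesis by blast
qed

section \<open>Linear maps and completion of orthonormal families\<close>

lemma mv_mv: "mv l B (mv p C x) r = (\<Sum>s<p. (\<Sum>t<l. B r t * C t s) * x s)"
  by (simp add: mv_def sum_distrib_left sum_distrib_right)
    (subst sum.swap, simp add: algebra_simps)

lemma mv_sum: "mv l B (\<lambda>j. \<Sum>a\<in>I. c a * e a j) r = (\<Sum>a\<in>I. c a * mv l B (e a) r)"
  by (simp add: mv_def sum_distrib_left) (subst sum.swap, simp add: algebra_simps)

lemma sqn_diff: "sqn d (\<lambda>i. x i - y i) = sqn d x + sqn d y - 2 * Re (cip d x y)"
proof -
  have "Re (cip d y x) = Re (cip d x y)"
    by (metis cnj_cip complex_cnj(1) cnj.simps(1))
  then have "Re (cip d (\<lambda>i. x i - y i) (\<lambda>i. x i - y i)) = sqn d x + sqn d y - 2 * Re (cip d x y)"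
    unfolding cip_diff_left cip_diff_right by simp
  then show ?thesis by simp
qed

lemma orthonormal_insert_exists:
  assumes "k < d"
  shows "\<exists>u. sqn d u = 1 \<and> (\<forall>a<k. cip d (e a) u = 0)"
proof -
  obtain c where c: "\<exists>i<d. c i \<noteq> 0" "\<forall>a<k. (\<Sum>i<d. cnj (e a i) * c i) = 0"
    using homogeneous_system_solution[OF assms, of "\<lambda>a i. cnj (e a i)"] by blast
  have "sqn d c \<noteq> 0"
    using c(1) by (auto simp: sqn_zero_iff)
  then have pos: "sqn d c > 0"
    using sqn_nonneg[of d c] by linarith
  define z where "z = complex_of_real (1 / sqrt (sqn d c))"
  have "sqn d (\<lambda>i. z * c i) = 1"
    unfolding sqn_scale using pos by (simp add: z_def norm_divide power_divide)
  moreover have "cip d (e a) (\<lambda>i. z * c i) = 0" if "a < k" for a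
    using c(2) that unfolding cip_scale_right by (simp add: cip_def)
  ultimately show ?thesis by blast
qed

lemma orthonormal_update:
  assumes "orthonormal d {..<k} e" "sqn d u = 1" "\<forall>a<k. cip d (e a) u = 0"
  shows "orthonormal d {..<Suc k} (e(k := u))"
  unfolding orthonormal_def
proof (intro ballI)
  fix a b assume "a \<in> {..<Suc k}" "b \<in> {..<Suc k}"
  moreover have "cip d u (e c) = 0" if "c < k" for c
    using assms(3) that by (metis cnj_cip complex_cnj_zero)
  ultimately show "cip d ((e(k := u)) a) ((e(k := u)) b) = (if a = b then 1 else 0)"
    using assms orthonormalD[OF assms(1), of a b]
    by (cases "a = k"; cases "b = k") (auto simp: cip_self)
qed

lemma orthonormal_extend:
  assumes "orthonormal d {..<k} e" "k \<le> d"
  shows "\<exists>e'. orthonormal d {..<d} e' \<and> (\<forall>a<k. e' a = e a)"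
proof -
  have "l \<le> d \<longrightarrow> (\<exists>e'. orthonormal d {..<l} e' \<and> (\<forall>a<k. e' a = e a))" if "k \<le> l" for l
    using that
  proof (induction l rule: dec_induct)
    case base
    then show ?case using assms by blast
  next
    case (step l)
    show ?case
    proof
      assume l: "Suc l \<le> d"
      then obtain e' where e': "orthonormal d {..<l} e'" "\<forall>a<k. e' a = e a"
        using step by auto
      obtain u where "sqn d u = 1" "\<forall>a<l. cip d (e' a) u = 0"
        using orthonormal_insert_exists[of l d e'] l by auto
      from orthonormal_update[OF e'(1) this] e'(2) step(1)
      show "\<exists>e'. orthonormal d {..<Suc l} e' \<and> (\<forall>a<k. e' a = e a)"
        by (intro exI[of _ "e'(l := u)"]) auto
    qed
  qed
  then show ?thesis using assms(2) by blast
qed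

text \<open>Expanding the squares shows that |A e - \<alpha> e| equals |A* e - cnj \<alpha> e|,
  because normality equates |A e| and |A* e|. The first of these vanishes.\<close>

lemma normal_eigenvector_adj:
  assumes "\<And>x. sqn d (mv d A x) = sqn d (mv d (adj A) x)"
    and "\<And>r. r < d \<Longrightarrow> mv d A e r = \<alpha> * e r" and "r < d"
  shows "mv d (adj A) e r = cnj \<alpha> * e r"
proof -
  have "sqn d (\<lambda>r. mv d A e r - \<alpha> * e r) = 0"
    using assms(2) by (simp add: sqn_zero_iff)
  moreover have "Re (cip d (mv d A e) (\<lambda>r. \<alpha> * e r)) = Re (cip d (mv d (adj A) e) (\<lambda>r. cnj \<alpha> * e r))"
  proof -
    have "cip d (mv d A e) (\<lambda>r. \<alpha> * e r) = cnj (cip d (mv d (adj A) e) (\<lambda>r. cnj \<alpha> * e r))"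
      unfolding cip_scale_right by (simp add: cnj_cip cip_mv_left)
    then show ?thesis by simp
  qed
  ultimately have "sqn d (\<lambda>r. mv d (adj A) e r - cnj \<alpha> * e r) = 0"
    unfolding sqn_diff using assms(1)[of e] by (simp add: sqn_scale)
  then show ?thesis
    using assms(3) by (simp add: sqn_zero_iff)
qed

text \<open>Induction on the number of eigenvectors. Those already found are eigenvectors of the
  adjoint too, so their orthogonal complement is invariant under \<open>A\<close>, and an
  eigenvector of the compression of \<open>A\<close> to it is one of \<open>A\<close>.\<close>

lemma normal_orthonormal_eigenvectors:
  assumes normal: "\<And>x. sqn d (mv d A x) = sqn d (mv d (adj A) x)" and "k \<le> d"
  shows "\<exists>e \<alpha>. orthonormal d {..<k} e \<and> (\<forall>a<k. \<forall>r<d. mv d A (e a) r = \<alpha> a * e a r)"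
  using \<open>k \<le> d\<close>
proof (induction k)
  case 0
  then show ?case by (auto simp: orthonormal_def)
next
  case (Suc k)
  then obtain e0 \<alpha> where e0: "orthonormal d {..<k} e0"
    and ev0: "\<forall>a<k. \<forall>r<d. mv d A (e0 a) r = \<alpha> a * e0 a r"
    by auto
  obtain e where e: "orthonormal d {..<d} e" and ee0: "\<forall>a<k. e a = e0 a"
    using orthonormal_extend[OF e0] Suc.prems by auto
  have ev: "mv d A (e a) r = \<alpha> a * e a r" if "a < k" "r < d" for a r
    using ev0 ee0 that by simp
  define p where "p = d - k"
  have p: "0 < p" "\<And>j. j < p \<Longrightarrow> k + j < d"
    using Suc.prems by (auto simp: p_def)
  \<comment> \<open>The compression of \<open>A\<close> to the complement, in the basis
    \<open>e k\<close>, ..., \<open>e (d - 1)\<close>. The vector \<open>w\<close> below is its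
    eigenvector \<open>c\<close> in the original coordinates.\<close>
  define B where "B = (\<lambda>i j. cip d (e (k + i)) (mv d A (e (k + j))))"
  obtain \<mu> c where c: "sqn p c = 1" "\<forall>i<p. (\<Sum>j<p. B i j * c j) = \<mu> * c i"
    using unit_eigenvector_exists[OF p(1), of B] by blast
  define w where "w = (\<lambda>r. \<Sum>j<p. c j * e (k + j) r)"
  have on: "orthonormal d {..<p} (\<lambda>j. e (k + j))"
    unfolding orthonormal_def using p by (auto simp: orthonormalD[OF e])
  have w1: "sqn d w = 1"
    unfolding w_def using orthonormal_sqn_sum[OF on, of c] c(1) by (simp add: sqn_def)
  have w0: "cip d (e a) w = 0" if "a < k" for a
    unfolding w_def cip_sum_right using that p Suc.prems by (auto simp: orthonormalD[OF e] intro!: sum.neutral)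
  have wi: "cip d (e (k + i)) w = c i" if "i < p" for i
    unfolding w_def using orthonormal_cip_sum[OF on, of i c] that by simp
  \<comment> \<open>The eigenvector equation is checked on the coordinates in the basis
    \<open>e\<close>: for \<open>a < k\<close> both sides are zero, for the other \<open>a\<close>
    it is the equation of the compression.\<close>
  have coord: "cip d (e a) (mv d A w) = \<mu> * cip d (e a) w" if "a < d" for a
  proof (cases "a < k")
    case True
    have "cip d (e a) (mv d A w) = cip d (\<lambda>r. cnj (\<alpha> a) * e a r) w"
      unfolding cip_mv_right
      by (intro cip_cong refl normal_eigenvector_adj[OF normal]) (auto simp: ev True)
    then show ?thesis
      unfolding cip_scale_left using w0[OF True] by simp
  next
    case False
    define i where "i = a - k"
    have i: "a = k + i" "i < p"
      using False that by (auto simp: i_def p_def)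
    have "cip d (e a) (mv d A w) = cip d (e a) (\<lambda>r. \<Sum>j<p. c j * mv d A (e (k + j)) r)"
      unfolding w_def by (intro cip_cong refl mv_sum)
    also have "\<dots> = (\<Sum>j<p. B i j * c j)"
      unfolding cip_sum_right B_def i by (simp add: mult.commute)
    finally show ?thesis
      using c(2) i wi by simp
  qed
  have Aw: "mv d A w r = \<mu> * w r" if "r < d" for r
  proof -
    have "mv d A w r = (\<Sum>a<d. cip d (e a) (mv d A w) * e a r)"
      using orthonormal_expand[OF e that] by simp
    also have "\<dots> = \<mu> * (\<Sum>a<d. cip d (e a) w * e a r)"
      using coord by (simp add: sum_distrib_left algebra_simps)
    finally show ?thesis
      using orthonormal_expand[OF e that] by simp
  qed
  have "orthonormal d {..<Suc k} (e(k := w))"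
    by (rule orthonormal_update[OF orthonormal_subset[OF e]]) (use w1 w0 Suc.prems in auto)
  moreover have "\<forall>a<Suc k. \<forall>r<d. mv d A ((e(k := w)) a) r = (\<alpha>(k := \<mu>)) a * (e(k := w)) a r"
    using ev Aw by (auto simp: less_Suc_eq)
  ultimately show ?case by blast
qed

text \<open>The entries of the sum of the matrices \<alpha>_a e_a e_a^*, where \<open>d\<close>
  counts the vectors. Neither orthonormality nor a relation between \<open>d\<close> and the length
  of the vectors is built in, so one form covers spectral decompositions and the sums over the
  vectors \<open>b j\<close>.\<close>

definition specf :: "nat \<Rightarrow> (nat \<Rightarrow> nat \<Rightarrow> complex) \<Rightarrow> (nat \<Rightarrow> complex) \<Rightarrow> nat \<Rightarrow> nat \<Rightarrow> complex" where
  "specf d e \<alpha> r s = (\<Sum>a<d. \<alpha> a * e a r * cnj (e a s))"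

lemma mv_specf: "mv l (specf d e \<alpha>) y r = (\<Sum>a<d. \<alpha> a * cip l (e a) y * e a r)"
  unfolding mv_def specf_def cip_def sum_distrib_left sum_distrib_right
  by (subst sum.swap) (simp add: algebra_simps)

lemma cip_specf: "cip n x (mv l (specf d e \<alpha>) y) = (\<Sum>a<d. \<alpha> a * cip n x (e a) * cip l (e a) y)"
  unfolding mv_specf cip_sum_right by (simp add: algebra_simps)

lemma mv_specf_eigenvector:
  assumes "orthonormal d {..<d} e" "b < d"
  shows "mv d (specf d e \<alpha>) (e b) r = \<alpha> b * e b r"
proof -
  have "mv d (specf d e \<alpha>) (e b) r = (\<Sum>a<d. if a = b then \<alpha> b * e b r else 0)"
    unfolding mv_specf using assms by (intro sum.cong) (auto simp: orthonormalD)
  then show ?thesis using assms by simp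
qed

text \<open>\<open>A\<close> is multiplied on the right by the identity, written as the sum of all
  e_a e_a^*.\<close>

lemma entry_orthonormal_expand:
  assumes "orthonormal d {..<d} e" "s < d"
  shows "(\<Sum>a<d. mv d A (e a) r * cnj (e a s)) = A r s"
proof -
  have "(\<Sum>a<d. mv d A (e a) r * cnj (e a s)) = (\<Sum>t<d. A r t * (\<Sum>a<d. e a t * cnj (e a s)))"
    unfolding mv_def sum_distrib_left sum_distrib_right by (subst sum.swap) (simp add: algebra_simps)
  also have "\<dots> = (\<Sum>t<d. if t = s then A r t else 0)"
    using orthonormal_complete[OF assms(1) _ assms(2)] by (intro sum.cong) auto
  finally show ?thesis using assms by simp
qed

lemma normal_spectral:
  assumes "\<And>r s. r < d \<Longrightarrow> s < d \<Longrightarrow> (\<Sum>t<d. A r t * cnj (A s t)) = (\<Sum>t<d. cnj (A t r) * A t s)"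
  shows "\<exists>e \<alpha>. orthonormal d {..<d} e \<and> (\<forall>r<d. \<forall>s<d. A r s = specf d e \<alpha> r s)"
proof -
  have normal: "sqn d (mv d A x) = sqn d (mv d (adj A) x)" for x
  proof -
    have "cip d (mv d A x) (mv d A x) = cip d (mv d (adj A) x) (mv d (adj A) x)"
      unfolding cip_mv_left using assms
      by (intro cip_cong refl) (simp add: mv_mv, simp add: adj_def)
    then show ?thesis by (simp add: cip_self)
  qed
  obtain e \<alpha> where e: "orthonormal d {..<d} e" and ev: "\<forall>a<d. \<forall>r<d. mv d A (e a) r = \<alpha> a * e a r"
    using normal_orthonormal_eigenvectors[OF normal order_refl] by blast
  have "A r s = specf d e \<alpha> r s" if "r < d" "s < d" for r s
  proof -
    have "specf d e \<alpha> r s = (\<Sum>a<d. mv d A (e a) r * cnj (e a s))"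
      unfolding specf_def using ev that by simp
    then show ?thesis using entry_orthonormal_expand[OF e that(2)] by simp
  qed
  with e show ?thesis by blast
qed

lemma decreasing_reindex:
  fixes \<mu> :: "nat \<Rightarrow> real"
  shows "\<exists>\<pi>. bij_betw \<pi> {..<d} {..<d} \<and> (\<forall>a b. a \<le> b \<longrightarrow> b < d \<longrightarrow> \<mu> (\<pi> b) \<le> \<mu> (\<pi> a))"
proof -
  define xs where "xs = sort_key (\<lambda>i. - \<mu> i) [0..<d]"
  have xs: "length xs = d" "distinct xs" "set xs = {..<d}" "sorted (map (\<lambda>i. - \<mu> i) xs)"
    by (auto simp: xs_def)
  have "bij_betw ((!) xs) {..<d} {..<d}"
    using bij_betw_nth[OF xs(2)] xs(1,3) by simp
  moreover have "\<mu> (xs ! b) \<le> \<mu> (xs ! a)" if "a \<le> b" "b < d" for a b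
    using sorted_nth_mono[OF xs(4), of a b] xs(1) that by simp
  ultimately show ?thesis by blast
qed

text \<open>The quadratic form at a unit eigenvector equals both the eigenvalue and its conjugate,
  so the eigenvalues are real and can be sorted. The decreasing order turns sums of the largest
  eigenvalues into initial sums.\<close>

lemma hermitian_spectral:
  assumes herm: "\<And>r s. r < d \<Longrightarrow> s < d \<Longrightarrow> A r s = cnj (A s r)"
  shows "\<exists>e \<mu>. orthonormal d {..<d} e \<and> (\<forall>a b. a \<le> b \<longrightarrow> b < d \<longrightarrow> \<mu> b \<le> \<mu> a) \<and>
    (\<forall>r<d. \<forall>s<d. A r s = specf d e (\<lambda>a. complex_of_real (\<mu> a)) r s)"
proof -
  have "(\<Sum>t<d. A r t * cnj (A s t)) = (\<Sum>t<d. cnj (A t r) * A t s)" if "r < d" "s < d" for r s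
    proof (intro sum.cong refl)
    fix t assume "t \<in> {..<d}"
    then show "A r t * cnj (A s t) = cnj (A t r) * A t s"
      using herm[of r t] herm[of t s] that by simp
  qed
  from normal_spectral[of d A, OF this] obtain e \<alpha> where e: "orthonormal d {..<d} e"
    and A: "\<forall>r<d. \<forall>s<d. A r s = specf d e \<alpha> r s" by blast
  have real: "\<alpha> b = complex_of_real (Re (\<alpha> b))" if "b < d" for b
  proof -
    have ev: "mv d A (e b) r = \<alpha> b * e b r" if "r < d" for r
      using mv_specf_eigenvector[OF e \<open>b < d\<close>, of \<alpha> r] A that by (simp add: mv_def)
    have adj: "mv d (adj A) (e b) r = \<alpha> b * e b r" if "r < d" for r
    proof -
      have "mv d (adj A) (e b) r = mv d A (e b) r"
        unfolding mv_def adj_def using that by (intro sum.cong refl) (simp add: herm[of r])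
      then show ?thesis using ev[OF that] by simp
    qed
    have "\<alpha> b = cip d (e b) (mv d A (e b))"
      using cip_cong[of d "e b" "e b" "mv d A (e b)" "\<lambda>r. \<alpha> b * e b r"] ev
        orthonormalD[OF e, of b b] that by (simp add: cip_scale_right)
    moreover have "cip d (e b) (mv d A (e b)) = cnj (\<alpha> b)"
      unfolding cip_mv_right
      using cip_cong[of d "mv d (adj A) (e b)" "\<lambda>r. \<alpha> b * e b r" "e b" "e b"] adj
        orthonormalD[OF e, of b b] that by (simp add: cip_scale_left)
    ultimately show ?thesis
      by (simp add: complex_eq_iff)
  qed
  obtain \<pi> where \<pi>: "bij_betw \<pi> {..<d} {..<d}"
    "\<forall>a b. a \<le> b \<longrightarrow> b < d \<longrightarrow> Re (\<alpha> (\<pi> b)) \<le> Re (\<alpha> (\<pi> a))"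
    using decreasing_reindex[of d "\<lambda>a. Re (\<alpha> a)"] by blast
  have "orthonormal d {..<d} (\<lambda>a. e (\<pi> a))"
    unfolding orthonormal_def
  proof (intro ballI)
    fix a b assume "a \<in> {..<d}" "b \<in> {..<d}"
    then have "\<pi> a \<in> {..<d}" "\<pi> b \<in> {..<d}" "\<pi> a = \<pi> b \<longleftrightarrow> a = b"
      using \<pi>(1) by (auto simp: bij_betw_def inj_on_def)
    then show "cip d (e (\<pi> a)) (e (\<pi> b)) = (if a = b then 1 else 0)"
      using orthonormalD[OF e, of "\<pi> a" "\<pi> b"] by simp
  qed
  moreover have "A r s = specf d (\<lambda>a. e (\<pi> a)) (\<lambda>a. complex_of_real (Re (\<alpha> (\<pi> a)))) r s"
    if "r < d" "s < d" for r s
  proof -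
    have "A r s = (\<Sum>a<d. complex_of_real (Re (\<alpha> a)) * e a r * cnj (e a s))"
      using A that real by (simp add: specf_def)
    also have "\<dots> = specf d (\<lambda>a. e (\<pi> a)) (\<lambda>a. complex_of_real (Re (\<alpha> (\<pi> a)))) r s"
      unfolding specf_def by (rule sum.reindex_bij_betw[OF \<pi>(1), symmetric])
    finally show ?thesis .
  qed
  ultimately show ?thesis
    using \<pi>(2) by (intro exI[of _ "\<lambda>a. e (\<pi> a)"] exI[of _ "\<lambda>a. Re (\<alpha> (\<pi> a))"]) auto
qed

section \<open>Inequalities for sums of eigenvalues\<close>

lemma weighted_sum_le_top_sum:
  fixes c \<tau> :: "nat \<Rightarrow> real"
  assumes dec: "\<And>a b. a \<le> b \<Longrightarrow> b < d \<Longrightarrow> c b \<le> c a" and nonneg: "\<And>a. a < d \<Longrightarrow> 0 \<le> c a"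
    and \<tau>: "\<And>a. a < d \<Longrightarrow> 0 \<le> \<tau> a" "\<And>a. a < d \<Longrightarrow> \<tau> a \<le> 1"
    and sum: "(\<Sum>a<d. \<tau> a) \<le> real k" and "k \<le> d"
  shows "(\<Sum>a<d. c a * \<tau> a) \<le> (\<Sum>a<k. c a)"
proof -
  \<comment> \<open>For \<open>k = d\<close> there is no tail; the value 0 is then still a lower
    bound of all coefficients.\<close>
  define m where "m = (if k < d then c k else 0)"
  have m: "0 \<le> m" using nonneg by (simp add: m_def)
  have split: "{..<d} = {..<k} \<union> {k..<d}" "{..<k} \<inter> {k..<d} = {}"
    using \<open>k \<le> d\<close> by auto
  have "(\<Sum>a<d. c a * \<tau> a) = (\<Sum>a<k. c a * \<tau> a) + (\<Sum>a\<in>{k..<d}. c a * \<tau> a)"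
    unfolding split(1) by (rule sum.union_disjoint) auto
  also have "(\<Sum>a\<in>{k..<d}. c a * \<tau> a) \<le> (\<Sum>a\<in>{k..<d}. m * \<tau> a)"
    using dec \<tau> by (intro sum_mono mult_right_mono) (auto simp: m_def)
  also have "(\<Sum>a\<in>{k..<d}. m * \<tau> a) = m * ((\<Sum>a<d. \<tau> a) - (\<Sum>a<k. \<tau> a))"
    unfolding split(1) by (subst sum.union_disjoint) (auto simp: sum_distrib_left)
  also have "\<dots> \<le> m * (real k - (\<Sum>a<k. \<tau> a))"
    using m sum by (intro mult_left_mono) auto
  also have "\<dots> = (\<Sum>a<k. m * (1 - \<tau> a))"
    by (simp add: sum_distrib_left[symmetric] sum_subtractf)
  also have "\<dots> \<le> (\<Sum>a<k. c a * (1 - \<tau> a))"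
    using dec \<tau> nonneg \<open>k \<le> d\<close> by (intro sum_mono mult_right_mono) (auto simp: m_def)
  also have "(\<Sum>a<k. c a * \<tau> a) + (\<Sum>a<k. c a * (1 - \<tau> a)) = (\<Sum>a<k. c a)"
    unfolding sum.distrib[symmetric] by (simp add: algebra_simps)
  finally show ?thesis by simp
qed

text \<open>Ky Fan's maximum principle for B* B in terms of the eigenvalues of B B*. The vectors B*
  x_a take the place of an eigenbasis of B* B: they are orthogonal and have the squared lengths
  \<open>c a\<close>.\<close>

lemma ky_fan_gram:
  assumes x: "orthonormal d {..<d} x"
    and gram: "\<And>r s. r < d \<Longrightarrow> s < d \<Longrightarrow>
      (\<Sum>j<l. B r j * cnj (B s j)) = specf d x (\<lambda>a. complex_of_real (c a)) r s"
    and dec: "\<And>a b. a \<le> b \<Longrightarrow> b < d \<Longrightarrow> c b \<le> c a"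
    and y: "orthonormal l {..<k} y" and "k \<le> d"
  shows "(\<Sum>t<k. sqn d (mv l B (y t))) \<le> (\<Sum>a<k. c a)"
proof -
  define D where "D = (\<lambda>a. mv d (adj B) (x a))"
  have DD: "cip l (D a) (D b) = (if a = b then of_real (c a) else 0)" if "a < d" "b < d" for a b
  proof -
    have "cip l (D a) (D b) = cip d (x a) (mv l B (mv d (adj B) (x b)))"
      unfolding D_def cip_mv_right ..
    also have "\<dots> = cip d (x a) (mv d (specf d x (\<lambda>a. complex_of_real (c a))) (x b))"
      by (intro cip_cong refl) (simp add: mv_mv, simp add: mv_def adj_def gram)
    also have "\<dots> = cip d (x a) (\<lambda>r. of_real (c b) * x b r)"
      by (intro cip_cong refl mv_specf_eigenvector[OF x that(2)])
    also have "\<dots> = (if a = b then of_real (c a) else 0)"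
      unfolding cip_scale_right using that by (simp add: orthonormalD[OF x])
    finally show ?thesis .
  qed
  have sqnD: "sqn l (D a) = c a" if "a < d" for a
    using DD[OF that that] by (simp add: cip_self)
  have c0: "0 \<le> c a" if "a < d" for a
    using sqnD[OF that] sqn_nonneg[of l "D a"] by simp
  define I where "I = {a. a < d \<and> c a > 0}"
  define u where "u = (\<lambda>a j. complex_of_real (1 / sqrt (c a)) * D a j)"
  have I: "finite I" "I \<subseteq> {..<d}" by (auto simp: I_def)
  have u: "orthonormal l I u"
    unfolding orthonormal_def
  proof (intro ballI)
    fix a b assume "a \<in> I" "b \<in> I"
    then have "a < d" "b < d" "c a > 0" by (auto simp: I_def)
    then show "cip l (u a) (u b) = (if a = b then 1 else 0)"
      unfolding u_def cip_scale_left cip_scale_right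
      by (auto simp: DD of_real_mult[symmetric] simp del: of_real_mult)
  qed
  \<comment> \<open>The share of \<open>u a\<close> in the span of the \<open>y t\<close>: at most 1
    by Bessel for \<open>y\<close>, in total at most \<open>k\<close> by Bessel for
    \<open>u\<close>. Off \<open>I\<close> the vector \<open>D a\<close> vanishes, so the value 0
    keeps \<open>row\<close> valid.\<close>
  define \<tau> where "\<tau> = (\<lambda>a. if a \<in> I then \<Sum>t<k. (cmod (cip l (y t) (u a)))\<^sup>2 else 0)"
  have \<tau>0: "0 \<le> \<tau> a" for a by (simp add: \<tau>_def sum_nonneg)
  have \<tau>1: "\<tau> a \<le> 1" for a
    using bessel[OF y, of "u a"] orthonormal_sqn[OF u, of a] by (auto simp: \<tau>_def)
  have "(\<Sum>a<d. \<tau> a) = (\<Sum>a\<in>I. \<Sum>t<k. (cmod (cip l (y t) (u a)))\<^sup>2)"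
    unfolding \<tau>_def using I by (simp add: sum.If_cases Int_absorb1)
  also have "\<dots> = (\<Sum>t<k. \<Sum>a\<in>I. (cmod (cip l (u a) (y t)))\<^sup>2)"
    by (subst sum.swap) (simp add: cmod_cip_commute[of l "y _"])
  also have "\<dots> \<le> (\<Sum>t<k. 1)"
    by (intro sum_mono) (metis bessel[OF u I(1)] orthonormal_sqn[OF y])
  finally have \<tau>k: "(\<Sum>a<d. \<tau> a) \<le> real k" by simp
  have row: "(\<Sum>t<k. (cmod (cip l (D a) (y t)))\<^sup>2) = c a * \<tau> a" if "a < d" for a
  proof (cases "a \<in> I")
    case True
    then have "c a > 0" by (simp add: I_def)
    then have "D a = (\<lambda>j. complex_of_real (sqrt (c a)) * u a j)"
      by (auto simp: u_def)
    then show ?thesis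
      using True \<open>c a > 0\<close>
      by (simp add: \<tau>_def cip_scale_left norm_mult power_mult_distrib sum_distrib_left
          cmod_cip_commute[of l "y _"])
  next
    case False
    then have "sqn l (D a) = 0" using that c0[OF that] sqnD by (auto simp: I_def)
    then have "cip l (D a) (y t) = 0" for t by (simp add: sqn_zero_iff cip_def)
    then show ?thesis using False by (simp add: \<tau>_def)
  qed
  have "(\<Sum>t<k. sqn d (mv l B (y t))) = (\<Sum>t<k. \<Sum>a<d. (cmod (cip l (D a) (y t)))\<^sup>2)"
    unfolding parseval[OF x, symmetric] D_def cip_mv_right ..
  also have "\<dots> = (\<Sum>a<d. c a * \<tau> a)"
    by (subst sum.swap) (simp add: row)
  also have "\<dots> \<le> (\<Sum>a<k. c a)"
    by (rule weighted_sum_le_top_sum[OF dec c0 \<tau>0 \<tau>1 \<tau>k \<open>k \<le> d\<close>])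
  finally show ?thesis .
qed

section \<open>Averages of two Gram matrices\<close>

lemma half_gram_form:
  assumes "\<And>i j. i < l \<Longrightarrow> j < l \<Longrightarrow>
    G i j = ((\<Sum>r<n. cnj (P r i) * P r j) + (\<Sum>r<n. cnj (Q r i) * Q r j)) / 2"
  shows "cip l y (mv l G y) = of_real ((sqn n (mv l P y) + sqn n (mv l Q y)) / 2)"
proof -
  have "mv l G y i = (1/2) * (mv n (adj P) (mv l P y) i + mv n (adj Q) (mv l Q y) i)" if "i < l" for i
  proof -
    have "mv l G y i = (\<Sum>j<l. ((\<Sum>r<n. cnj (P r i) * P r j) + (\<Sum>r<n. cnj (Q r i) * Q r j)) / 2 * y j)"
      unfolding mv_def using assms[OF that] by (intro sum.cong refl) (simp only: lessThan_iff)
    also have "\<dots> = (1/2) * ((\<Sum>j<l. (\<Sum>r<n. adj P i r * P r j) * y j) + (\<Sum>j<l. (\<Sum>r<n. adj Q i r * Q r j) * y j))"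
      unfolding sum.distrib[symmetric] sum_distrib_left[of "1/2"] adj_def
      by (intro sum.cong refl) (simp add: algebra_simps add_divide_distrib)
    finally show ?thesis unfolding mv_mv .
  qed
  then have "cip l y (mv l G y)
    = cip l y (\<lambda>i. (1/2) * (mv n (adj P) (mv l P y) i + mv n (adj Q) (mv l Q y) i))"
    by (intro cip_cong) auto
  also have "\<dots> = (1/2) * (cip n (mv l P y) (mv l P y) + cip n (mv l Q y) (mv l Q y))"
    unfolding cip_scale_right cip_add_right cip_mv_left by simp
  finally show ?thesis by (simp add: cip_self)
qed

text \<open>The quadratic form is evaluated at an eigenvector. This yields nonnegative eigenvalues
  and splits a sum of eigenvalues into the contributions of the two factors.\<close>

lemma half_gram_eigenvalue:
  assumes "\<And>i j. i < l \<Longrightarrow> j < l \<Longrightarrow>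
    specf l g (\<lambda>a. complex_of_real (\<mu> a)) i j
      = ((\<Sum>r<n. cnj (P r i) * P r j) + (\<Sum>r<n. cnj (Q r i) * Q r j)) / 2"
    and g: "orthonormal l {..<l} g" and "a < l"
  shows "\<mu> a = (sqn n (mv l P (g a)) + sqn n (mv l Q (g a))) / 2"
proof -
  have "cip l (g a) (mv l (specf l g (\<lambda>a. complex_of_real (\<mu> a))) (g a)) = of_real (\<mu> a)"
    unfolding mv_specf_eigenvector[OF g \<open>a < l\<close>, abs_def] cip_scale_right
    using orthonormalD[OF g, of a a] \<open>a < l\<close> by simp
  with half_gram_form[where l = l and G = "specf l g (\<lambda>a. complex_of_real (\<mu> a))" and n = n and P = P and Q = Q and y = "g a", OF assms(1)] show ?thesis
    by (metis of_real_eq_iff)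
qed

text \<open>The arithmetic--geometric mean inequality of Bhatia and Kittaneh for singular values.\<close>

lemma singular_value_le_half_gram_eigenvalue:
  assumes v: "orthonormal n {..<Suc p} v" and w: "orthonormal n {..<Suc p} w"
    and sv: "\<And>i r. i \<le> p \<Longrightarrow> r < n \<Longrightarrow> mv l Q (mv n (adj P) (v i)) r = of_real (\<sigma> i) * w i r"
    and \<sigma>: "\<And>i. i \<le> p \<Longrightarrow> \<sigma> p \<le> \<sigma> i"
    and g: "orthonormal l {..<l} g" and dec: "\<And>a b. a \<le> b \<Longrightarrow> b < l \<Longrightarrow> \<mu> b \<le> \<mu> a"
    and gram: "\<And>i j. i < l \<Longrightarrow> j < l \<Longrightarrow> specf l g (\<lambda>a. complex_of_real (\<mu> a)) i j
      = ((\<Sum>r<n. cnj (P r i) * P r j) + (\<Sum>r<n. cnj (Q r i) * Q r j)) / 2"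
    and "p < l"
  shows "\<sigma> p \<le> \<mu> p"
proof -
  \<comment> \<open>Averages of Q* w_i and P* v_i. There are \<open>p + 1\<close> coefficients for
    \<open>p\<close> linear conditions, so a nontrivial combination \<open>y\<close> of the
    \<open>z i\<close> is orthogonal to the first \<open>p\<close> eigenvectors
    \<open>g a\<close>.\<close>
  define z where "z = (\<lambda>i j. (mv n (adj Q) (w i) j + mv n (adj P) (v i) j) / 2)"
  obtain c where c: "\<exists>i<Suc p. c i \<noteq> 0" "\<forall>a<p. (\<Sum>i<Suc p. cip l (g a) (z i) * c i) = 0"
    using homogeneous_system_solution[of p "Suc p" "\<lambda>a i. cip l (g a) (z i)"] by auto
  define S where "S = (\<Sum>i<Suc p. (cmod (c i))\<^sup>2)"
  have S: "S > 0"
    using c(1) by (auto simp: S_def intro: sum_pos2 simp del: sum.lessThan_Suc)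
  define W where "W = (\<lambda>r. \<Sum>i<Suc p. c i * w i r)"
  define V where "V = (\<lambda>r. \<Sum>i<Suc p. c i * v i r)"
  have WS: "sqn n W = S" "sqn n V = S"
    unfolding W_def V_def S_def using v w by (simp_all only: orthonormal_sqn_sum finite_lessThan)
  define A where "A = mv n (adj Q) W"
  define B where "B = mv n (adj P) V"
  define y where "y = (\<lambda>j. (1/2) * (A j + B j))"
  have y_sum: "y = (\<lambda>j. \<Sum>i<Suc p. c i * z i j)"
    unfolding y_def A_def B_def W_def V_def mv_sum z_def sum_distrib_left sum.distrib[symmetric]
    by (intro ext sum.cong refl) (simp add: algebra_simps add_divide_distrib)
  have y0: "cip l (g a) y = 0" if "a < p" for a
    unfolding y_sum cip_sum_right using c(2) that by (simp add: mult.commute)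
  have "cip l A B = cip n W (mv l Q B)"
    unfolding A_def cip_mv_right ..
  also have "\<dots> = cip n W (\<lambda>r. \<Sum>i<Suc p. c i * \<sigma> i * w i r)"
  proof (intro cip_cong refl)
    fix r assume "r < n"
    have "mv l Q B r = mv l Q (\<lambda>j. \<Sum>i<Suc p. c i * mv n (adj P) (v i) j) r"
      unfolding B_def V_def mv_sum ..
    also have "\<dots> = (\<Sum>i<Suc p. c i * \<sigma> i * w i r)"
      unfolding mv_sum using sv \<open>r < n\<close> by (intro sum.cong) auto
    finally show "mv l Q B r = (\<Sum>i<Suc p. c i * \<sigma> i * w i r)" .
  qed
  also have "\<dots> = (\<Sum>i<Suc p. cnj (c i) * (c i * \<sigma> i))"
    unfolding W_def cip_sum_left
    by (intro sum.cong refl) (subst orthonormal_cip_sum[OF w], auto)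
  also have "\<dots> = of_real (\<Sum>i<Suc p. (cmod (c i))\<^sup>2 * \<sigma> i)"
    unfolding mult.assoc[symmetric] cnj_mult_self by simp
  finally have "Re (cip l A B) = (\<Sum>i<Suc p. (cmod (c i))\<^sup>2 * \<sigma> i)" by simp
  also have "\<dots> \<ge> (\<Sum>i<Suc p. (cmod (c i))\<^sup>2 * \<sigma> p)"
    using \<sigma> by (intro sum_mono mult_left_mono) auto
  finally have AB: "\<sigma> p * S \<le> Re (cip l A B)"
    unfolding S_def sum_distrib_right[symmetric] by (simp only: mult.commute)
  have cy: "cip l y y = (1/4) * (cip l A A + cip l A B + cip l B A + cip l B B)"
    unfolding y_def cip_scale_left cip_scale_right cip_add_left cip_add_right by simp
  have "Re (cip l B A) = Re (cip l A B)"
    using arg_cong[OF cnj_cip[of l A B], of Re] by simp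
  then have "sqn l y = (1/4) * (sqn l A + sqn l B + 2 * Re (cip l A B))"
    using arg_cong[OF cy, of Re] by simp
  moreover have "0 \<le> sqn l A + sqn l B - 2 * Re (cip l A B)"
    using sqn_diff[of l A B] sqn_nonneg[of l "\<lambda>i. A i - B i"] by simp
  \<comment> \<open>As \<open>y\<close> is half of \<open>A + B\<close>, this is the inequality |A +
    B|^2 \<ge> 4 Re <A, B>.\<close>
  ultimately have low: "\<sigma> p * S \<le> sqn l y"
    using AB by simp
  define q where "q = sqn n (mv l Q y)"
  define h where "h = sqn n (mv l P y)"
  \<comment> \<open>For the upper bound one copy of \<open>y\<close> is expanded and the adjoints
    are moved over. Cauchy-Schwarz then bounds |y|^4 by \<open>S\<close> times the quadratic form of
    the average at \<open>y\<close>, to which only the \<open>\<mu> a\<close> with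
    \<open>a \<ge> p\<close> contribute.\<close>
  have "cip l y y = (1/2) * (cip n (mv l Q y) W + cip n (mv l P y) V)"
    unfolding cip_mv_left A_def[symmetric] B_def[symmetric]
    by (subst (2) y_def) (simp only: cip_scale_right cip_add_right)
  then have "sqn l y = cmod ((1/2) * (cip n (mv l Q y) W + cip n (mv l P y) V))"
    by (metis cip_self norm_of_real abs_of_nonneg sqn_nonneg)
  also have "\<dots> \<le> (cmod (cip n (mv l Q y) W) + cmod (cip n (mv l P y) V)) / 2"
    using norm_triangle_ineq[of "cip n (mv l Q y) W" "cip n (mv l P y) V"]
    by (simp add: norm_mult)
  finally have "(sqn l y)\<^sup>2 \<le> ((cmod (cip n (mv l Q y) W) + cmod (cip n (mv l P y) V)) / 2)\<^sup>2"
    by (intro power_mono) auto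
  also have "\<dots> \<le> ((cmod (cip n (mv l Q y) W))\<^sup>2 + (cmod (cip n (mv l P y) V))\<^sup>2) / 2"
    using sum_squares_bound[of "cmod (cip n (mv l Q y) W)" "cmod (cip n (mv l P y) V)"]
    by (simp add: power2_eq_square field_simps)
  also have "\<dots> \<le> (q * S + h * S) / 2"
    using cip_cauchy_schwarz[of n "mv l Q y" W] cip_cauchy_schwarz[of n "mv l P y" V]
    by (simp add: WS q_def h_def)
  also have "\<dots> = (h + q) / 2 * S"
    by (simp add: algebra_simps)
  also have "(h + q) / 2 = (\<Sum>a<l. \<mu> a * (cmod (cip l (g a) y))\<^sup>2)"
  proof -
    have "complex_of_real ((h + q) / 2) = (\<Sum>a<l. of_real (\<mu> a) * (cip l y (g a) * cip l (g a) y))"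
      using half_gram_form[where l = l and G = "specf l g (\<lambda>a. complex_of_real (\<mu> a))" and n = n and P = P and Q = Q and y = y, OF gram]
      unfolding h_def[symmetric] q_def[symmetric] cip_specf by (simp add: mult.assoc)
    also have "\<dots> = of_real (\<Sum>a<l. \<mu> a * (cmod (cip l (g a) y))\<^sup>2)"
      by (simp only: cnj_cip[of l "g _", symmetric] cnj_mult_self of_real_sum of_real_mult)
    finally show ?thesis using of_real_eq_iff by blast
  qed
  also have "(\<Sum>a<l. \<mu> a * (cmod (cip l (g a) y))\<^sup>2) \<le> (\<Sum>a<l. \<mu> p * (cmod (cip l (g a) y))\<^sup>2)"
  proof (rule sum_mono)
    fix a assume "a \<in> {..<l}"
    then show "\<mu> a * (cmod (cip l (g a) y))\<^sup>2 \<le> \<mu> p * (cmod (cip l (g a) y))\<^sup>2"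
      using y0[of a] dec[of p a] by (cases "a < p") (auto intro: mult_right_mono)
  qed
  also have "\<dots> = \<mu> p * sqn l y"
    unfolding sum_distrib_left[symmetric] parseval[OF g] ..
  finally have up: "(sqn l y)\<^sup>2 \<le> \<mu> p * sqn l y * S"
    using S by simp
  have "\<mu> p = (sqn n (mv l P (g p)) + sqn n (mv l Q (g p))) / 2"
    by (rule half_gram_eigenvalue[OF _ g \<open>p < l\<close>]) (rule gram)
  then have \<mu>p: "0 \<le> \<mu> p"
    by (simp only: sqn_nonneg add_nonneg_nonneg divide_nonneg_nonneg zero_le_numeral)
  \<comment> \<open>\<open>up\<close> is divided by |y|^2; if \<open>y\<close> vanishes,
    \<open>low\<close> already gives \<open>\<sigma> p \<le> 0\<close>.\<close>
  show ?thesis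
  proof (cases "sqn l y = 0")
    case True
    then have "\<sigma> p \<le> 0" using low S by (simp add: mult_le_0_iff)
    then show ?thesis using \<mu>p by simp
  next
    case False
    then have "sqn l y > 0" using sqn_nonneg[of l y] by linarith
    moreover have "sqn l y * sqn l y \<le> \<mu> p * S * sqn l y"
      using up by (simp only: power2_eq_square mult.assoc mult.commute[of S])
    ultimately have "sqn l y \<le> \<mu> p * S"
      by (rule mult_right_le_imp_le[rotated])
    then have "\<sigma> p * S \<le> \<mu> p * S" using low by simp
    then show ?thesis using S by simp
  qed
qed

section \<open>Concave functions of singular values\<close>

text \<open>A decrease from \<open>x\<close> to \<open>y\<close> would, by concavity, force a
  negative value further out.\<close>

lemma concave_nonneg_mono:
  fixes f :: "real \<Rightarrow> real"
  assumes f: "concave_on {0..} f" and nonneg: "\<And>x. 0 \<le> x \<Longrightarrow> 0 \<le> f x" and "0 \<le> x" "x \<le> y"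
  shows "f x \<le> f y"
proof (rule ccontr)
  assume *: "\<not> f x \<le> f y"
  then have less: "f y < f x" "x < y"
    using \<open>x \<le> y\<close> by (auto simp: order.order_iff_strict)
  have fy: "0 \<le> f y" using nonneg assms by simp
  \<comment> \<open>The weight makes \<open>(1 - t) * f x\<close> the midpoint of \<open>f x\<close>
    and \<open>f y\<close>, which exceeds \<open>f y\<close>; \<open>z\<close> is the point beyond
    \<open>y\<close> that puts \<open>y\<close> at weight \<open>t\<close> between \<open>x\<close>
    and \<open>z\<close>.\<close>
  define t where "t = (f x - f y) / (2 * f x)"
  have t: "0 < t" "t \<le> 1"
    using less fy by (auto simp: t_def field_simps)
  define z where "z = x + (y - x) / t"
  have z: "0 \<le> z" using t less \<open>0 \<le> x\<close> by (simp add: z_def)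
  have "(1 - t) * f x + t * f z \<le> f ((1 - t) *\<^sub>R x + t *\<^sub>R z)"
    using concave_onD[OF f, of t x z] t z \<open>0 \<le> x\<close> by simp
  also have "(1 - t) *\<^sub>R x + t *\<^sub>R z = y"
    using t by (simp add: z_def field_simps)
  finally have "(1 - t) * f x \<le> f y"
    using nonneg[OF z] t mult_nonneg_nonneg[of t "f z"] by linarith
  moreover have "(1 - t) * f x = (f x + f y) / 2"
    using less fy by (simp add: t_def field_simps)
  ultimately show False using less by simp
qed

text \<open>\<open>s\<close> is the convex combination of \<open>0\<close> and \<open>t\<close> with
  weight \<open>s / t\<close> at \<open>t\<close>, and \<open>f 0 = 0\<close> removes the other
  term.\<close>

lemma concave_ratio_antimono:
  fixes f :: "real \<Rightarrow> real"
  assumes f: "concave_on {0..} f" and "f 0 = 0" and "0 < s" "s \<le> t"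
  shows "f t / t \<le> f s / s"
proof -
  have "(s / t) * f t \<le> f ((s / t) * t)"
    using concave_onD[OF f, of "s / t" 0 t] assms by simp
  then show ?thesis using assms by (simp add: field_simps)
qed

text \<open>The number \<open>\<kappa>\<close> is the slope of \<open>f\<close> at the last summed eigenvalue; the positive part of
  \<open>\<kappa> t - f t\<close> is convex, and Jensen's inequality is applied to it instead of to \<open>f\<close>.\<close>

lemma concave_doubly_stochastic_sum_le:
  fixes f :: "real \<Rightarrow> real" and W :: "nat \<Rightarrow> nat \<Rightarrow> real"
  assumes f: "concave_on {0..} f" and f0: "f 0 = 0" and nonneg: "\<And>x. 0 \<le> x \<Longrightarrow> 0 \<le> f x"
    and W: "\<And>i j. i < d \<Longrightarrow> j < d \<Longrightarrow> 0 \<le> W i j"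
      "\<And>i. i < d \<Longrightarrow> (\<Sum>j<d. W i j) = 1" "\<And>j. j < d \<Longrightarrow> (\<Sum>i<d. W i j) = 1"
    and \<mu>: "\<And>i. i < d \<Longrightarrow> 0 \<le> \<mu> i" "\<And>i j. i \<le> j \<Longrightarrow> j < d \<Longrightarrow> \<mu> j \<le> \<mu> i"
    and \<beta>: "\<And>j. j < d \<Longrightarrow> 0 \<le> \<beta> j" "\<And>j. j < d \<Longrightarrow> \<beta> j \<le> (\<Sum>i<d. \<mu> i * W i j)"
      "\<And>j. j < d \<Longrightarrow> \<beta> j = 0 \<Longrightarrow> (\<Sum>i<d. \<mu> i * W i j) = 0"
    and "k \<le> d"
  shows "(\<Sum>i<k. f (\<mu> i)) \<le> (\<Sum>i<k. \<Sum>j<d. \<mu> i * W i j * (f (\<beta> j) / \<beta> j))"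
proof -
  \<comment> \<open>The line of slope \<open>\<kappa>\<close> through the origin lies above
    \<open>f\<close> at the first \<open>k\<close> values and below it at the remaining ones. If the
    last summed value is positive, the ratio of \<open>f\<close> there has this property, as ratios
    decrease.\<close>
  have "\<exists>\<kappa>\<ge>0. (\<forall>i<k. f (\<mu> i) \<le> \<kappa> * \<mu> i) \<and> (\<forall>i. k \<le> i \<longrightarrow> i < d \<longrightarrow> \<kappa> * \<mu> i \<le> f (\<mu> i))"
  proof (cases "k = 0 \<or> \<mu> (k - 1) > 0")
    case True
    show ?thesis
    proof (cases "k = 0")
      case True
      then show ?thesis using nonneg \<mu> by (intro exI[of _ 0]) auto
    next
      case False
      then have pos: "\<mu> (k - 1) > 0" using True by simp
      define \<kappa> where "\<kappa> = f (\<mu> (k - 1)) / \<mu> (k - 1)"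
      have "f (\<mu> i) \<le> \<kappa> * \<mu> i" if "i < k" for i
      proof -
        have "\<mu> (k - 1) \<le> \<mu> i" using \<mu>(2)[of i "k - 1"] that \<open>k \<le> d\<close> by simp
        with concave_ratio_antimono[OF f f0 pos this] pos show ?thesis
          by (simp add: \<kappa>_def pos_divide_le_eq)
      qed
      moreover have "\<kappa> * \<mu> i \<le> f (\<mu> i)" if "k \<le> i" "i < d" for i
      proof (cases "\<mu> i = 0")
        case True
        then show ?thesis by (simp add: f0)
      next
        case False
        then have "\<mu> i > 0" using \<mu>(1) that by (simp add: order_less_le)
        moreover have "\<mu> i \<le> \<mu> (k - 1)" using \<mu>(2)[of "k - 1" i] that by simp
        ultimately show ?thesis
          using concave_ratio_antimono[OF f f0, of "\<mu> i" "\<mu> (k - 1)"]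
          by (simp add: \<kappa>_def pos_le_divide_eq)
      qed
      moreover have "0 \<le> \<kappa>" using nonneg pos by (simp add: \<kappa>_def)
      ultimately show ?thesis by blast
    qed
  next
    case False
    then have k: "k > 0" "\<mu> (k - 1) = 0" using \<mu>(1)[of "k - 1"] \<open>k \<le> d\<close> by auto
    \<comment> \<open>Here the last summed value and all later ones are zero, so
      \<open>\<kappa>\<close> only has to dominate the ratios of the first \<open>k\<close>. Ratios
      with \<open>\<mu> i = 0\<close> are 0 by the convention on division.\<close>
    define \<kappa> where "\<kappa> = (\<Sum>i<k. f (\<mu> i) / \<mu> i)"
    have t0: "0 \<le> f (\<mu> i) / \<mu> i" if "i < k" for i
      using nonneg \<mu> that \<open>k \<le> d\<close> by simp
    have "f (\<mu> i) \<le> \<kappa> * \<mu> i" if "i < k" for i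
    proof (cases "\<mu> i = 0")
      case True
      then show ?thesis by (simp add: f0)
    next
      case False
      then have "\<mu> i > 0" using \<mu>(1)[of i] that \<open>k \<le> d\<close> by simp
      moreover have "f (\<mu> i) / \<mu> i \<le> \<kappa>"
        unfolding \<kappa>_def using that t0 by (intro member_le_sum) auto
      ultimately show ?thesis by (simp add: pos_divide_le_eq)
    qed
    moreover have "\<kappa> * \<mu> i \<le> f (\<mu> i)" if "k \<le> i" "i < d" for i
    proof -
      have "\<mu> i = 0" using \<mu>(2)[of "k - 1" i] \<mu>(1)[of i] k that by simp
      then show ?thesis by (simp add: f0)
    qed
    moreover have "0 \<le> \<kappa>" unfolding \<kappa>_def using t0 by (intro sum_nonneg) auto
    ultimately show ?thesis by blast
  qed
  then obtain \<kappa> where \<kappa>: "\<kappa> \<ge> 0" "\<forall>i<k. f (\<mu> i) \<le> \<kappa> * \<mu> i"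
    "\<forall>i. k \<le> i \<longrightarrow> i < d \<longrightarrow> \<kappa> * \<mu> i \<le> f (\<mu> i)" by blast
  define g where "g = (\<lambda>t. max 0 (\<kappa> * t - f t))"
  define \<rho> where "\<rho> = (\<lambda>j. \<Sum>i<d. \<mu> i * W i j)"
  have g0: "0 \<le> g t" for t by (simp add: g_def)
  have \<mu>W: "0 \<le> \<mu> i * W i j" if "i < d" "j < d" for i j
    using \<mu>(1) W(1) that by simp
  have \<rho>0: "0 \<le> \<rho> j" if "j < d" for j
    unfolding \<rho>_def using \<mu>W that by (intro sum_nonneg) auto
  \<comment> \<open>\<open>g (\<rho> j) / \<rho> j\<close> covers the gap between
    \<open>\<kappa>\<close> and the ratio of \<open>f\<close> at \<open>\<rho> j\<close>, which is
    at most the ratio at the smaller \<open>\<beta> j\<close>. The value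
    \<open>\<beta> j = 0\<close> occurs only with \<open>\<rho> j = 0\<close>, and then the whole
    column of terms vanishes.\<close>
  have low: "\<kappa> * (\<mu> i * W i j) - \<mu> i * W i j * (g (\<rho> j) / \<rho> j) \<le> \<mu> i * W i j * (f (\<beta> j) / \<beta> j)"
    if "i < k" "j < d" for i j
  proof (cases "\<rho> j = 0")
    case True
    then have "\<mu> i * W i j = 0"
      using sum_nonneg_eq_0_iff[of "{..<d}" "\<lambda>i. \<mu> i * W i j"] \<mu>W that \<open>k \<le> d\<close>
      unfolding \<rho>_def by auto
    then show ?thesis by (simp only: mult_zero_left mult_zero_right)
  next
    case False
    then have \<beta>pos: "0 < \<beta> j" "\<beta> j \<le> \<rho> j"
      using \<beta>[OF that(2)] unfolding \<rho>_def by (auto simp: order_less_le)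
    then have "f (\<rho> j) / \<rho> j \<le> f (\<beta> j) / \<beta> j"
      by (intro concave_ratio_antimono[OF f f0])
    moreover have "\<kappa> - f (\<rho> j) / \<rho> j \<le> g (\<rho> j) / \<rho> j"
      using divide_right_mono[of "\<kappa> * \<rho> j - f (\<rho> j)" "g (\<rho> j)" "\<rho> j"] \<beta>pos False
      by (simp add: g_def diff_divide_distrib)
    ultimately have "\<kappa> - g (\<rho> j) / \<rho> j \<le> f (\<beta> j) / \<beta> j" by linarith
    from mult_left_mono[OF this \<mu>W[of i j]] that \<open>k \<le> d\<close>
    show ?thesis by (simp add: algebra_simps)
  qed
  have jensen: "g (\<rho> j) \<le> (\<Sum>i<d. W i j * g (\<mu> i))" if "j < d" for j
  proof -
    have "(\<Sum>i<d. W i j * f (\<mu> i)) \<le> f (\<Sum>i<d. W i j *\<^sub>R \<mu> i)"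
      using that \<mu> W by (intro concave_on_sum[OF _ _ f]) auto
    then have "\<kappa> * \<rho> j - f (\<rho> j) \<le> \<kappa> * (\<Sum>i<d. W i j * \<mu> i) - (\<Sum>i<d. W i j * f (\<mu> i))"
      by (simp add: \<rho>_def mult.commute)
    also have "\<dots> = (\<Sum>i<d. W i j * (\<kappa> * \<mu> i - f (\<mu> i)))"
      by (simp add: sum_distrib_left sum_subtractf algebra_simps)
    also have "\<dots> \<le> (\<Sum>i<d. W i j * g (\<mu> i))"
      using W(1) that by (intro sum_mono mult_left_mono) (auto simp: g_def)
    finally have "\<kappa> * \<rho> j - f (\<rho> j) \<le> (\<Sum>i<d. W i j * g (\<mu> i))" .
    moreover have "0 \<le> (\<Sum>i<d. W i j * g (\<mu> i))"
      using W(1) that g0 by (intro sum_nonneg mult_nonneg_nonneg) auto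
    ultimately show ?thesis by (simp add: g_def)
  qed
  \<comment> \<open>Nonnegative terms allow all rows to be included, which produces the column sums
    \<open>\<rho> j\<close>. After Jensen, the choice of \<open>\<kappa>\<close> makes
    \<open>g\<close> vanish at \<open>\<mu> i\<close> for \<open>i \<ge> k\<close>.\<close>
  have "(\<Sum>i<k. \<Sum>j<d. \<mu> i * W i j * (g (\<rho> j) / \<rho> j)) \<le> (\<Sum>i<d. \<Sum>j<d. \<mu> i * W i j * (g (\<rho> j) / \<rho> j))"
  proof (rule sum_mono2)
    fix i assume "i \<in> {..<d} - {..<k}"
    then show "0 \<le> (\<Sum>j<d. \<mu> i * W i j * (g (\<rho> j) / \<rho> j))"
      using \<mu>W \<rho>0 g0 by (intro sum_nonneg mult_nonneg_nonneg[of "\<mu> i * W i _"]) auto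
  qed (use \<open>k \<le> d\<close> in auto)
  also have "\<dots> = (\<Sum>j<d. \<rho> j * (g (\<rho> j) / \<rho> j))"
    by (subst sum.swap) (simp only: \<rho>_def sum_distrib_right)
  also have "\<dots> \<le> (\<Sum>j<d. g (\<rho> j))"
    using g0 by (intro sum_mono) auto
  also have "\<dots> \<le> (\<Sum>j<d. \<Sum>i<d. W i j * g (\<mu> i))"
    using jensen by (intro sum_mono) auto
  also have "\<dots> = (\<Sum>i<d. g (\<mu> i))"
    using W(2) by (subst sum.swap) (simp add: sum_distrib_right[symmetric])
  also have "\<dots> = (\<Sum>i<k. g (\<mu> i))"
    using \<open>k \<le> d\<close> \<kappa>(3) by (intro sum.mono_neutral_right) (auto simp: g_def)
  also have "\<dots> = (\<Sum>i<k. \<kappa> * \<mu> i - f (\<mu> i))"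
    using \<kappa>(2) by (intro sum.cong) (auto simp: g_def)
  finally have "(\<Sum>i<k. \<Sum>j<d. \<mu> i * W i j * (g (\<rho> j) / \<rho> j)) \<le> (\<Sum>i<k. \<kappa> * \<mu> i) - (\<Sum>i<k. f (\<mu> i))"
    by (simp only: sum_subtractf)
  moreover have "(\<Sum>i<k. \<Sum>j<d. \<kappa> * (\<mu> i * W i j)) = (\<Sum>i<k. \<kappa> * \<mu> i)"
    using W(2) \<open>k \<le> d\<close> by (intro sum.cong refl) (simp add: sum_distrib_left[symmetric])
  moreover have "(\<Sum>i<k. \<Sum>j<d. \<kappa> * (\<mu> i * W i j)) - (\<Sum>i<k. \<Sum>j<d. \<mu> i * W i j * (g (\<rho> j) / \<rho> j))
    \<le> (\<Sum>i<k. \<Sum>j<d. \<mu> i * W i j * (f (\<beta> j) / \<beta> j))"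
    unfolding sum_subtractf[symmetric] using low by (intro sum_mono) auto
  ultimately show ?thesis by linarith
qed

section \<open>Initial sums of concave functions of singular values\<close>

lemma orthonormal_unit: "orthonormal d {..<d} (\<lambda>t i. if i = t then 1 else 0)"
  by (auto simp: orthonormal_def cip_def if_distrib[of cnj] if_distrib[of "\<lambda>z. z * _"] cong: if_cong)

lemma mv_unit: "t < l \<Longrightarrow> mv l B (\<lambda>i. if i = t then 1 else 0) r = B r t"
  by (simp add: mv_def if_distrib[of "\<lambda>z. _ * z"] cong: if_cong)

lemma Re_specf_diag: "Re (specf d e (\<lambda>a. complex_of_real (\<mu> a)) r r) = (\<Sum>a<d. \<mu> a * (cmod (e a r))\<^sup>2)"
  by (simp only: specf_def mult.assoc cnj_mult_self of_real_mult[symmetric] of_real_sum[symmetric] Re_complex_of_real)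

text \<open>The comparison for one family \<open>b\<close> and \<open>f 0 = 0\<close>. The
  hypothesis on the images of \<open>v\<close> says that \<open>v\<close> and
  \<open>\<sigma>\<close> are right singular vectors and singular values; left ones are formed only
  where \<open>\<sigma>\<close> is positive.\<close>

lemma concave_singular_value_sum_le:
  fixes f :: "real \<Rightarrow> real"
  assumes f: "concave_on {0..} f" "f 0 = 0" "\<And>x. 0 \<le> x \<Longrightarrow> 0 \<le> f x"
    and b: "\<And>j. j < l \<Longrightarrow> 1 \<le> sqn n (b j)" and "n \<le> l"
    and v: "orthonormal n {..<n} v"
    and sv: "\<And>i j. i < n \<Longrightarrow> j < n \<Longrightarrow>
      cip n (mv n (specf l b \<alpha>) (v i)) (mv n (specf l b \<alpha>) (v j)) = (if i = j then of_real ((\<sigma> i)\<^sup>2) else 0)"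
    and \<sigma>: "\<And>i j. i \<le> j \<Longrightarrow> j < n \<Longrightarrow> \<sigma> j \<le> \<sigma> i" "\<And>i. i < n \<Longrightarrow> 0 \<le> \<sigma> i"
    and x: "orthonormal n {..<n} x"
    and C: "\<And>r s. r < n \<Longrightarrow> s < n \<Longrightarrow> specf l b (\<lambda>j. complex_of_real (f (cmod (\<alpha> j)))) r s
      = specf n x (\<lambda>a. complex_of_real (c a)) r s"
    and c: "\<And>i j. i \<le> j \<Longrightarrow> j < n \<Longrightarrow> c j \<le> c i" and "k \<le> n"
  shows "(\<Sum>i<k. f (\<sigma> i)) \<le> (\<Sum>i<k. c i)"
proof -
  define \<beta> where "\<beta> = (\<lambda>j. cmod (\<alpha> j))"
  \<comment> \<open>The phase of \<open>\<alpha> j\<close>, with value 1 at zero so that it is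
    always unimodular.\<close>
  define \<theta> where "\<theta> = (\<lambda>j. if \<alpha> j = 0 then 1 else \<alpha> j / of_real (\<beta> j))"
  have \<beta>0: "0 \<le> \<beta> j" for j by (simp add: \<beta>_def)
  have \<theta>1: "cmod (\<theta> j) = 1" for j by (simp add: \<theta>_def \<beta>_def norm_divide)
  have \<theta>c: "cnj (\<theta> j) * \<theta> j = 1" "\<theta> j * cnj (\<theta> j) = 1" for j
    unfolding cnj_mult_self \<theta>1 by simp_all
  have \<beta>\<theta>: "of_real (\<beta> j) * \<theta> j = \<alpha> j" for j by (simp add: \<theta>_def \<beta>_def)
  have sqrtc: "complex_of_real (sqrt t) * complex_of_real (sqrt t) = of_real t" if "0 \<le> t" for t
    using that by (simp add: of_real_mult[symmetric] del: of_real_mult)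
  \<comment> \<open>For \<open>\<beta> j = 0\<close> the quotient is 0 by convention. This agrees
    with \<open>f 0 = 0\<close>, so that \<open>h j * \<beta> j\<close> is
    \<open>f (\<beta> j)\<close> for every \<open>j\<close>.\<close>
  define h where "h = (\<lambda>j. f (\<beta> j) / \<beta> j)"
  have h0: "0 \<le> h j" for j using f(3)[OF \<beta>0] \<beta>0 by (simp add: h_def)
  define w where "w = (\<lambda>j. h j * \<beta> j)"
  have w: "w j = f (\<beta> j)" for j using f(2) by (simp add: w_def h_def)
  define P where "P = (\<lambda>r j. complex_of_real (sqrt (\<beta> j)) * b j r)"
  define Q where "Q = (\<lambda>r j. complex_of_real (sqrt (\<beta> j)) * \<theta> j * b j r)"
  define G where "G = (\<lambda>i j. ((\<Sum>r<n. cnj (P r i) * P r j) + (\<Sum>r<n. cnj (Q r i) * Q r j)) / 2)"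
  have Gherm: "G i j = cnj (G j i)" for i j
    by (simp add: G_def mult.commute)
  obtain g \<mu> where g: "orthonormal l {..<l} g" and \<mu>dec: "\<forall>a b. a \<le> b \<longrightarrow> b < l \<longrightarrow> \<mu> b \<le> \<mu> a"
    and Gg: "\<forall>i<l. \<forall>j<l. G i j = specf l g (\<lambda>a. complex_of_real (\<mu> a)) i j"
    using hermitian_spectral[of l G, OF Gherm] by blast
  have gram: "specf l g (\<lambda>a. complex_of_real (\<mu> a)) i j
      = ((\<Sum>r<n. cnj (P r i) * P r j) + (\<Sum>r<n. cnj (Q r i) * Q r j)) / 2" if "i < l" "j < l" for i j
    using Gg that unfolding G_def by simp
  have \<mu>0: "0 \<le> \<mu> a" if "a < l" for a
  proof -
    have "\<mu> a = (sqn n (mv l P (g a)) + sqn n (mv l Q (g a))) / 2"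
      by (rule half_gram_eigenvalue[OF _ g that]) (rule gram)
    then show ?thesis
      by (simp only: sqn_nonneg add_nonneg_nonneg divide_nonneg_nonneg zero_le_numeral)
  qed
  have QP: "mv l Q (mv n (adj P) y) r = mv n (specf l b \<alpha>) y r" for y r
  proof -
    have "mv n (adj P) y j = of_real (sqrt (\<beta> j)) * cip n (b j) y" for j
      by (simp add: mv_def adj_def P_def cip_def sum_distrib_left mult.assoc)
    then have "mv l Q (mv n (adj P) y) r
      = (\<Sum>j<l. (of_real (sqrt (\<beta> j)) * of_real (sqrt (\<beta> j)) * \<theta> j) * cip n (b j) y * b j r)"
      by (simp add: mv_def[of l] Q_def algebra_simps)
    then show ?thesis
      unfolding mv_specf sqrtc[OF \<beta>0] \<beta>\<theta> .
  qed
  \<comment> \<open>The bound for the singular values of Q P*. A zero \<open>\<sigma> p\<close> is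
    treated apart because the left singular vectors arise by dividing by the
    \<open>\<sigma> i\<close>.\<close>
  have weyl: "\<sigma> p \<le> \<mu> p" if p: "p < n" for p
  proof (cases "\<sigma> p = 0")
    case True
    then show ?thesis using \<mu>0[of p] p \<open>n \<le> l\<close> by simp
  next
    case False
    then have pos: "\<sigma> i > 0" if "i \<le> p" for i
      using \<sigma>(1)[OF that p] \<sigma>(2)[OF p] by linarith
    define u where "u = (\<lambda>i r. complex_of_real (1 / \<sigma> i) * mv n (specf l b \<alpha>) (v i) r)"
    have u: "orthonormal n {..<Suc p} u"
      unfolding orthonormal_def
    proof (intro ballI)
      fix i j assume ij: "i \<in> {..<Suc p}" "j \<in> {..<Suc p}"
      then have "\<sigma> i > 0" "i < n" "j < n" using pos[of i] p by auto
      then show "cip n (u i) (u j) = (if i = j then 1 else 0)"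
        unfolding u_def cip_scale_left cip_scale_right
        by (auto simp: sv power2_eq_square)
    qed
    show ?thesis
    proof (rule singular_value_le_half_gram_eigenvalue[of n p v u l Q P \<sigma> g \<mu>])
      show "orthonormal n {..<Suc p} v" by (rule orthonormal_subset[OF v]) (use p in auto)
      show "mv l Q (mv n (adj P) (v i)) r = of_real (\<sigma> i) * u i r" if "i \<le> p" "r < n" for i r
        unfolding QP u_def using pos[OF that(1)] by simp
      show "\<sigma> p \<le> \<sigma> i" if "i \<le> p" for i using \<sigma>(1)[OF that p] .
    qed (use u g \<mu>dec gram p \<open>n \<le> l\<close> in auto)
  qed
  have "(\<Sum>i<k. f (\<sigma> i)) \<le> (\<Sum>i<k. f (\<mu> i))"
    using weyl \<sigma>(2) \<open>k \<le> n\<close> by (intro sum_mono concave_nonneg_mono[OF f(1,3)]) auto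
  also have "\<dots> \<le> (\<Sum>i<k. \<Sum>j<l. \<mu> i * (cmod (g i j))\<^sup>2 * h j)"
    unfolding h_def
  proof (rule concave_doubly_stochastic_sum_le[OF f])
    show "(\<Sum>j<l. (cmod (g i j))\<^sup>2) = 1" if "i < l" for i
      using orthonormal_sqn[OF g, of i] that by (simp add: sqn_def)
    show "(\<Sum>i<l. (cmod (g i j))\<^sup>2) = 1" if "j < l" for j
    proof -
      have "complex_of_real (\<Sum>i<l. (cmod (g i j))\<^sup>2) = of_real 1"
        unfolding of_real_sum cnj_mult_self(2)[symmetric] using orthonormal_complete[OF g that that] by simp
      then show ?thesis using of_real_eq_iff by blast
    qed
    \<comment> \<open>The diagonal of \<open>G\<close>. The phases cancel, and the lower bound on
      the lengths of the \<open>b j\<close> makes it dominate \<open>\<beta> j\<close>; this is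
      where expansiveness enters.\<close>
    have diag: "(\<Sum>i<l. \<mu> i * (cmod (g i j))\<^sup>2) = \<beta> j * sqn n (b j)" if "j < l" for j
    proof -
      have "(\<Sum>r<n. cnj (Q r j) * Q r j) = (\<Sum>r<n. cnj (P r j) * P r j)"
      proof (intro sum.cong refl)
        fix r
        have "cnj (Q r j) * Q r j = (cnj (\<theta> j) * \<theta> j) * (cnj (P r j) * P r j)"
          by (simp add: Q_def P_def algebra_simps)
        then show "cnj (Q r j) * Q r j = cnj (P r j) * P r j" by (simp only: \<theta>c mult_1_left)
      qed
      then have "specf l g (\<lambda>a. complex_of_real (\<mu> a)) j j = cip n (\<lambda>r. P r j) (\<lambda>r. P r j)"
        unfolding gram[OF that that] cip_def by simp
      also have "\<dots> = of_real (\<beta> j * sqn n (b j))"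
        unfolding P_def cip_scale_left cip_scale_right cip_self
        by (simp add: mult.assoc[symmetric] sqrtc[OF \<beta>0])
      finally show ?thesis
        using Re_specf_diag[of l g \<mu> j] by simp
    qed
    show "\<beta> j \<le> (\<Sum>i<l. \<mu> i * (cmod (g i j))\<^sup>2)" if "j < l" for j
      unfolding diag[OF that] using mult_left_mono[OF b[OF that] \<beta>0[of j]] by simp
    show "(\<Sum>i<l. \<mu> i * (cmod (g i j))\<^sup>2) = 0" if "j < l" "\<beta> j = 0" for j
      unfolding diag[OF that(1)] using that(2) by simp
  qed (use \<mu>0 \<mu>dec \<beta>0 \<open>k \<le> n\<close> \<open>n \<le> l\<close> in auto)
  also have "\<dots> \<le> (\<Sum>i<k. c i)"
  proof -
    define P' where "P' = (\<lambda>r j. complex_of_real (sqrt (w j)) * b j r)"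
    define Q' where "Q' = (\<lambda>r j. complex_of_real (sqrt (w j)) * \<theta> j * b j r)"
    have P'P: "P' r j = of_real (sqrt (h j)) * P r j" for r j
      by (simp add: P'_def P_def w_def real_sqrt_mult)
    have Q'Q: "Q' r j = of_real (sqrt (h j)) * Q r j" for r j
      by (simp add: Q'_def Q_def w_def real_sqrt_mult)
    \<comment> \<open>This is h^(1/2) G h^(1/2) for the diagonal matrix of \<open>h\<close>. Column
      \<open>t\<close> of the matrix \<open>B\<close> below is h^(1/2) \<mu>_t^(1/2) g_t, so B B* is
      \<open>H\<close>, and the sum to be bounded consists of the squared lengths of the first
      \<open>k\<close> columns.\<close>
    define H where "H = (\<lambda>i j. complex_of_real (sqrt (h i)) * of_real (sqrt (h j)) * G i j)"
    have "H i j = cnj (H j i)" for i j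
      using Gherm[of i j] by (simp add: H_def)
    from hermitian_spectral[of l H, OF this]
    obtain q \<gamma> where q: "orthonormal l {..<l} q" and \<gamma>dec: "\<forall>a b. a \<le> b \<longrightarrow> b < l \<longrightarrow> \<gamma> b \<le> \<gamma> a"
      and Hq: "\<forall>i<l. \<forall>j<l. H i j = specf l q (\<lambda>a. complex_of_real (\<gamma> a)) i j" by blast
    define B where "B = (\<lambda>j t. complex_of_real (sqrt (h j)) * of_real (sqrt (\<mu> t)) * g t j)"
    have "(\<Sum>t<k. sqn l (mv l B (\<lambda>i. if i = t then 1 else 0))) \<le> (\<Sum>a<k. \<gamma> a)"
    proof (rule ky_fan_gram[OF q])
      show "orthonormal l {..<k} (\<lambda>t i. if i = t then 1 else 0)"
        by (rule orthonormal_subset[OF orthonormal_unit]) (use \<open>k \<le> n\<close> \<open>n \<le> l\<close> in auto)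
      show "(\<Sum>j<l. B r j * cnj (B s j)) = specf l q (\<lambda>a. complex_of_real (\<gamma> a)) r s"
        if "r < l" "s < l" for r s
      proof -
        have "(\<Sum>j<l. B r j * cnj (B s j)) = (\<Sum>j<l. of_real (sqrt (h r)) * of_real (sqrt (h s)) *
            ((of_real (sqrt (\<mu> j)) * of_real (sqrt (\<mu> j))) * g j r * cnj (g j s)))"
          by (simp add: B_def algebra_simps)
        also have "\<dots> = (\<Sum>j<l. of_real (sqrt (h r)) * of_real (sqrt (h s)) *
            (of_real (\<mu> j) * g j r * cnj (g j s)))"
          using \<mu>0 by (intro sum.cong refl) (simp only: sqrtc lessThan_iff)
        also have "\<dots> = H r s"
          using Gg that by (simp add: H_def specf_def sum_distrib_left)
        finally show ?thesis using Hq that by simp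
      qed
    qed (use \<gamma>dec \<open>k \<le> n\<close> \<open>n \<le> l\<close> in auto)
    moreover have "sqn l (mv l B (\<lambda>i. if i = t then 1 else 0)) = (\<Sum>j<l. \<mu> t * (cmod (g t j))\<^sup>2 * h j)"
      if "t < k" for t
    proof -
      have t: "t < l" using that \<open>k \<le> n\<close> \<open>n \<le> l\<close> by simp
      show ?thesis
        unfolding sqn_def mv_unit[OF t]
        using h0 \<mu>0[OF t] by (intro sum.cong refl) (simp add: B_def norm_mult power_mult_distrib)
    qed
    ultimately have "(\<Sum>i<k. \<Sum>j<l. \<mu> i * (cmod (g i j))\<^sup>2 * h j) \<le> (\<Sum>a<k. \<gamma> a)"
      by simp
    \<comment> \<open>\<open>H\<close> is again an average of two Gram matrices, and both P' P'* and
      Q' Q'* equal the sum with eigenvalues \<open>c\<close>. Ky Fan's principle therefore bounds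
      each half.\<close>
    also have "\<dots> = (\<Sum>a<k. (sqn n (mv l P' (q a)) + sqn n (mv l Q' (q a))) / 2)"
    proof (intro sum.cong refl)
      fix a assume "a \<in> {..<k}"
      then have a: "a < l" using \<open>k \<le> n\<close> \<open>n \<le> l\<close> by simp
      show "\<gamma> a = (sqn n (mv l P' (q a)) + sqn n (mv l Q' (q a))) / 2"
      proof (rule half_gram_eigenvalue[OF _ q a])
        fix i j assume ij: "i < l" "j < l"
        have "H i j = ((\<Sum>r<n. cnj (P' r i) * P' r j) + (\<Sum>r<n. cnj (Q' r i) * Q' r j)) / 2"
          unfolding P'P Q'Q H_def G_def
          by (simp add: algebra_simps sum_distrib_left add_divide_distrib)
        then show "specf l q (\<lambda>a. complex_of_real (\<gamma> a)) i j
          = ((\<Sum>r<n. cnj (P' r i) * P' r j) + (\<Sum>r<n. cnj (Q' r i) * Q' r j)) / 2"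
          using Hq ij by simp
      qed
    qed
    also have "\<dots> = ((\<Sum>a<k. sqn n (mv l P' (q a))) + (\<Sum>a<k. sqn n (mv l Q' (q a)))) / 2"
      by (simp only: sum_divide_distrib[symmetric] sum.distrib)
    also have "\<dots> \<le> ((\<Sum>i<k. c i) + (\<Sum>i<k. c i)) / 2"
    proof -
      have qk: "orthonormal l {..<k} q"
        by (rule orthonormal_subset[OF q]) (use \<open>k \<le> n\<close> \<open>n \<le> l\<close> in auto)
      have w0: "0 \<le> w j" for j unfolding w using f(3)[OF \<beta>0] .
      have P'C: "(\<Sum>j<l. P' r j * cnj (P' s j)) = specf l b (\<lambda>j. complex_of_real (f (cmod (\<alpha> j)))) r s" for r s
      proof -
        have "(\<Sum>j<l. P' r j * cnj (P' s j))
          = (\<Sum>j<l. (of_real (sqrt (w j)) * of_real (sqrt (w j))) * b j r * cnj (b j s))"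
          by (simp add: P'_def algebra_simps)
        then show ?thesis
          unfolding sqrtc[OF w0] by (simp only: w \<beta>_def specf_def)
      qed
      have Q'C: "(\<Sum>j<l. Q' r j * cnj (Q' s j)) = (\<Sum>j<l. P' r j * cnj (P' s j))" for r s
      proof (intro sum.cong refl)
        fix j
        have "Q' r j * cnj (Q' s j) = (\<theta> j * cnj (\<theta> j)) * (P' r j * cnj (P' s j))"
          by (simp add: Q'_def P'_def algebra_simps)
        then show "Q' r j * cnj (Q' s j) = P' r j * cnj (P' s j)" by (simp only: \<theta>c mult_1_left)
      qed
      have "(\<Sum>a<k. sqn n (mv l P' (q a))) \<le> (\<Sum>i<k. c i)"
        by (rule ky_fan_gram[OF x _ c qk \<open>k \<le> n\<close>]) (auto simp: P'C C)
      moreover have "(\<Sum>a<k. sqn n (mv l Q' (q a))) \<le> (\<Sum>i<k. c i)"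
        by (rule ky_fan_gram[OF x _ c qk \<open>k \<le> n\<close>]) (auto simp: Q'C P'C C)
      ultimately show ?thesis by simp
    qed
    finally show ?thesis by simp
  qed
  finally show ?thesis .
qed

section \<open>Weak majorization and symmetric gauges\<close>

text \<open>Induction on the number of positions where \<open>a\<close> and \<open>c\<close> differ.
  An entry of \<open>c\<close> that is too small is raised by a transfer from an earlier one; if
  there is none, a larger entry is lowered. Both times \<open>c\<close> becomes a convex combination
  of itself and a vector of the same gauge.\<close>

lemma symmetric_gauge_weak_majorization:
  fixes \<Phi> :: "(nat \<Rightarrow> real) \<Rightarrow> real"
  assumes cong: "\<And>x y. (\<And>i. i < n \<Longrightarrow> x i = y i) \<Longrightarrow> \<Phi> x = \<Phi> y"
    and tri: "\<And>x y. \<Phi> (\<lambda>i. x i + y i) \<le> \<Phi> x + \<Phi> y"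
    and scale: "\<And>t x. \<Phi> (\<lambda>i. t * x i) = \<bar>t\<bar> * \<Phi> x"
    and swap: "\<And>x p q. p < n \<Longrightarrow> q < n \<Longrightarrow> \<Phi> (\<lambda>i. x (Transposition.transpose p q i)) = \<Phi> x"
    and flip: "\<And>x p. p < n \<Longrightarrow> \<Phi> (x(p := - x p)) = \<Phi> x"
    and dec: "\<And>i j. i \<le> j \<Longrightarrow> j < n \<Longrightarrow> a j \<le> a i" and nonneg: "\<And>i. i < n \<Longrightarrow> 0 \<le> a i"
    and sums: "\<And>k. k \<le> n \<Longrightarrow> (\<Sum>i<k. a i) \<le> (\<Sum>i<k. c i)"
  shows "\<Phi> a \<le> \<Phi> c"
  using sums
proof (induction "card {i. i < n \<and> a i \<noteq> c i}" arbitrary: c rule: less_induct)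
  case less
  have mix: "\<Phi> z \<le> \<Phi> x" if "\<Phi> y = \<Phi> x" "0 \<le> t" "t \<le> 1" "\<And>i. i < n \<Longrightarrow> z i = t * x i + (1 - t) * y i"
    for x y z t
  proof -
    have "\<Phi> z = \<Phi> (\<lambda>i. t * x i + (1 - t) * y i)" using that(4) by (rule cong)
    also have "\<dots> \<le> \<Phi> (\<lambda>i. t * x i) + \<Phi> (\<lambda>i. (1 - t) * y i)" by (rule tri)
    also have "\<dots> = \<Phi> x" unfolding scale using that by (simp add: algebra_simps)
    finally show ?thesis .
  qed
  show ?case
  proof (cases "\<exists>q<n. c q < a q")
    case True
    \<comment> \<open>The first deficient position: the partial sums through \<open>q\<close> could
      not satisfy \<open>sums\<close> without a surplus at some earlier \<open>p\<close>.\<close>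
    define q where "q = (LEAST q. q < n \<and> c q < a q)"
    have q: "q < n" "c q < a q"
      using LeastI_ex[of "\<lambda>q. q < n \<and> c q < a q"] True by (auto simp: q_def)
    have below: "a i \<le> c i" if "i < q" for i
      using not_less_Least[of i "\<lambda>q. q < n \<and> c q < a q"] that q by (auto simp: q_def[symmetric])
    have "\<exists>p<q. a p < c p"
    proof (rule ccontr)
      assume "\<not> (\<exists>p<q. a p < c p)"
      then have "(\<Sum>i<q. a i) = (\<Sum>i<q. c i)"
        using below by (intro sum.cong refl) (metis lessThan_iff linorder_not_less order_antisym)
      then show False using less.prems[of "Suc q"] q by simp
    qed
    then obtain p where p: "p < q" "a p < c p" by blast
    \<comment> \<open>The largest transfer that overshoots neither target, so that position
      \<open>p\<close> or position \<open>q\<close> agrees with \<open>a\<close> afterwards.\<close>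
    define \<delta> where "\<delta> = min (c p - a p) (a q - c q)"
    have \<delta>: "0 < \<delta>" "\<delta> \<le> c p - a p" "\<delta> \<le> a q - c q" using p q by (auto simp: \<delta>_def)
    have apq: "a q \<le> a p" using dec[of p q] p q by simp
    define c' where "c' = c(p := c p - \<delta>, q := c q + \<delta>)"
    have "\<Phi> c' \<le> \<Phi> c"
    proof (rule mix)
      show "\<Phi> (\<lambda>i. c (Transposition.transpose p q i)) = \<Phi> c" using swap p q by simp
      \<comment> \<open>Solves \<open>(1 - t) * (c p - c q) = \<delta>\<close>. The amount
        \<open>\<delta>\<close> does not exceed \<open>c p - c q\<close> because
        \<open>a q \<le> a p\<close>.\<close>
      define t where "t = 1 - \<delta> / (c p - c q)"
      have D: "0 < c p - c q" "\<delta> \<le> c p - c q" using \<delta> apq by linarith+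
      show "0 \<le> t" "t \<le> 1" using D \<delta> by (auto simp: t_def)
      have tD: "(1 - t) * (c p - c q) = \<delta>" using D by (simp add: t_def)
      show "c' i = t * c i + (1 - t) * c (Transposition.transpose p q i)" for i
        using p tD by (cases "i = p"; cases "i = q") (auto simp: c'_def algebra_simps)
    qed
    moreover have "\<Phi> a \<le> \<Phi> c'"
    proof (rule less.hyps)
      have "{i. i < n \<and> a i \<noteq> c' i} \<subseteq> {i. i < n \<and> a i \<noteq> c i}"
        using p q by (auto simp: c'_def split: if_splits)
      moreover have "\<exists>i. i < n \<and> a i \<noteq> c i \<and> a i = c' i"
      proof (cases "\<delta> = c p - a p")
        case True
        then show ?thesis using p q by (intro exI[of _ p]) (auto simp: c'_def)
      next
        case False
        then have "\<delta> = a q - c q" by (simp add: \<delta>_def min_def split: if_splits)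
        then show ?thesis using p q by (intro exI[of _ q]) (auto simp: c'_def)
      qed
      ultimately have "{i. i < n \<and> a i \<noteq> c' i} \<subset> {i. i < n \<and> a i \<noteq> c i}" by blast
      then show "card {i. i < n \<and> a i \<noteq> c' i} < card {i. i < n \<and> a i \<noteq> c i}"
        by (intro psubset_card_mono) auto
      show "(\<Sum>i<k. a i) \<le> (\<Sum>i<k. c' i)" if "k \<le> n" for k
      proof -
        have "c' i = c i - (if i = p then \<delta> else 0) + (if i = q then \<delta> else 0)" for i
          using p by (auto simp: c'_def)
        then have c's: "(\<Sum>i<k. c' i) = (\<Sum>i<k. c i) - (if p < k then \<delta> else 0) + (if q < k then \<delta> else 0)"
          by (simp add: sum.distrib sum_subtractf)
        \<comment> \<open>Only partial sums that contain \<open>p\<close> but not \<open>q\<close>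
          change. There every \<open>c i\<close> is at least \<open>a i\<close>, and the surplus at
          \<open>p\<close> alone covers \<open>\<delta>\<close>.\<close>
        show ?thesis
        proof (cases "p < k \<and> \<not> q < k")
          case True
          have "c p - a p \<le> (\<Sum>i<k. c i - a i)"
            using True below by (intro member_le_sum) auto
          then show ?thesis using c's True \<delta> by (simp add: sum_subtractf)
        next
          case False
          then show ?thesis using c's p less.prems[OF that] by auto
        qed
      qed
    qed
    ultimately show ?thesis by simp
  next
    case False
    then have le: "a i \<le> c i" if "i < n" for i using that by (meson linorder_not_less)
    show ?thesis
    proof (cases "\<exists>p<n. a p \<noteq> c p")
      case False
      then have "\<Phi> a = \<Phi> c" by (intro cong) auto
      then show ?thesis by simp
    next
      case True
      then obtain p where p: "p < n" "a p \<noteq> c p" by blast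
      have cp: "0 < c p" "a p \<le> c p" using le[OF p(1)] nonneg[OF p(1)] p(2) by auto
      define c' where "c' = c(p := a p)"
      have "\<Phi> c' \<le> \<Phi> c"
      proof (rule mix)
        show "\<Phi> (c(p := - c p)) = \<Phi> c" by (rule flip[OF p(1)])
        \<comment> \<open>The weight for which \<open>t * c p - (1 - t) * c p\<close> is
          \<open>a p\<close>.\<close>
        define t where "t = (1 + a p / c p) / 2"
        show "0 \<le> t" "t \<le> 1" using cp nonneg[OF p(1)] by (auto simp: t_def field_simps)
        have tc: "2 * (t * c p) = c p + a p" using cp by (simp add: t_def field_simps)
        show "c' i = t * c i + (1 - t) * (c(p := - c p)) i" for i
          using tc by (cases "i = p") (auto simp: c'_def algebra_simps)
      qed
      moreover have "\<Phi> a \<le> \<Phi> c'"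
      proof (rule less.hyps)
        have "{i. i < n \<and> a i \<noteq> c' i} \<subset> {i. i < n \<and> a i \<noteq> c i}"
          using p by (auto simp: c'_def)
        then show "card {i. i < n \<and> a i \<noteq> c' i} < card {i. i < n \<and> a i \<noteq> c i}"
          by (intro psubset_card_mono) auto
        show "(\<Sum>i<k. a i) \<le> (\<Sum>i<k. c' i)" if "k \<le> n" for k
          using le that by (intro sum_mono) (auto simp: c'_def)
      qed
      ultimately show ?thesis by simp
    qed
  qed
qed

text \<open>Ky Fan's principle in terms of spectral data. The total weight at \<open>y a\<close> is
  at most 1 by Bessel, and Parseval makes all weights add up to \<open>k\<close>.\<close>

lemma ky_fan_sum:
  assumes y: "orthonormal d {..<d} y" and dec: "\<And>a b. a \<le> b \<Longrightarrow> b < d \<Longrightarrow> c b \<le> c a"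
    and nonneg: "\<And>a. a < d \<Longrightarrow> 0 \<le> c a" and x: "orthonormal d {..<k} x" and "k \<le> d"
  shows "(\<Sum>i<k. \<Sum>a<d. c a * (cmod (cip d (y a) (x i)))\<^sup>2) \<le> (\<Sum>a<k. c a)"
proof -
  have "(\<Sum>i<k. \<Sum>a<d. c a * (cmod (cip d (y a) (x i)))\<^sup>2)
    = (\<Sum>a<d. c a * (\<Sum>i<k. (cmod (cip d (x i) (y a)))\<^sup>2))"
    by (subst sum.swap) (simp add: sum_distrib_left cmod_cip_commute[of d "x _"])
  also have "\<dots> \<le> (\<Sum>a<k. c a)"
  proof (rule weighted_sum_le_top_sum[OF dec nonneg])
    show "(\<Sum>i<k. (cmod (cip d (x i) (y a)))\<^sup>2) \<le> 1" if "a < d" for a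
      using bessel[OF x, of "y a"] orthonormal_sqn[OF y, of a] that by simp
    have "(\<Sum>a<d. \<Sum>i<k. (cmod (cip d (x i) (y a)))\<^sup>2) = (\<Sum>i<k. sqn d (x i))"
      by (subst sum.swap) (simp add: parseval[OF y] cmod_cip_commute[of d "x _"])
    also have "\<dots> = k" using orthonormal_sqn[OF x] by simp
    finally show "(\<Sum>a<d. \<Sum>i<k. (cmod (cip d (x i) (y a)))\<^sup>2) \<le> real k" by simp
  qed (auto simp: sum_nonneg \<open>k \<le> d\<close>)
  finally show ?thesis .
qed

section \<open>Functional calculus and symmetric norms of matrices\<close>

lemma mat_adjoint_carrier [simp]: "A \<in> carrier_mat n m \<Longrightarrow> mat_adjoint A \<in> carrier_mat m n"
  by (auto simp: mat_adjoint_def mat_of_rows_def)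

lemma index_mat_adjoint [simp]:
  "A \<in> carrier_mat n m \<Longrightarrow> i < m \<Longrightarrow> j < n \<Longrightarrow> mat_adjoint A $$ (i,j) = cnj (A $$ (j,i))"
  by (auto simp: mat_adjoint_def mat_of_rows_index)

lemma index_mult_carrier:
  "A \<in> carrier_mat n m \<Longrightarrow> B \<in> carrier_mat m p \<Longrightarrow> i < n \<Longrightarrow> j < p \<Longrightarrow>
    (A * B) $$ (i,j) = (\<Sum>k<m. A $$ (i,k) * B $$ (k,j))"
  by (auto simp: scalar_prod_def atLeast0LessThan)

definition mat_entry :: "complex mat \<Rightarrow> nat \<Rightarrow> nat \<Rightarrow> complex" where
  "mat_entry A r s = A $$ (r,s)"

definition cols_mat :: "nat \<Rightarrow> (nat \<Rightarrow> nat \<Rightarrow> complex) \<Rightarrow> complex mat" where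
  "cols_mat n e = mat n n (\<lambda>(r,a). e a r)"

definition spec_mat :: "nat \<Rightarrow> (nat \<Rightarrow> nat \<Rightarrow> complex) \<Rightarrow> (nat \<Rightarrow> real) \<Rightarrow> complex mat" where
  "spec_mat n e d = mat n n (\<lambda>(r,s). specf n e (\<lambda>a. complex_of_real (d a)) r s)"

lemma cols_mat_carrier [simp]: "cols_mat n e \<in> carrier_mat n n"
  by (simp add: cols_mat_def)

lemma spec_mat_carrier [simp]: "spec_mat n e d \<in> carrier_mat n n"
  by (simp add: spec_mat_def)

lemma real_diag_carrier [simp]: "real_diag n d \<in> carrier_mat n n"
  by (simp add: real_diag_def)

lemma index_spec_mat:
  "r < n \<Longrightarrow> s < n \<Longrightarrow> spec_mat n e d $$ (r,s) = specf n e (\<lambda>a. complex_of_real (d a)) r s"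
  by (simp add: spec_mat_def)

lemma unitary_cols_mat_iff: "unitary_mat n (cols_mat n e) \<longleftrightarrow> orthonormal n {..<n} e"
proof -
  have ent: "(mat_adjoint (cols_mat n e) * cols_mat n e) $$ (i,j) = cip n (e i) (e j)"
    if "i < n" "j < n" for i j
  proof -
    have "(mat_adjoint (cols_mat n e) * cols_mat n e) $$ (i,j)
      = (\<Sum>k<n. mat_adjoint (cols_mat n e) $$ (i,k) * cols_mat n e $$ (k,j))"
      by (rule index_mult_carrier[of _ n n _ n]) (use that in auto)
    also have "\<dots> = cip n (e i) (e j)"
      unfolding cip_def
    proof (intro sum.cong refl)
      fix k assume "k \<in> {..<n}"
      then show "mat_adjoint (cols_mat n e) $$ (i,k) * cols_mat n e $$ (k,j) = cnj (e i k) * e j k"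
        using that index_mat_adjoint[of "cols_mat n e" n n i k] by (simp add: cols_mat_def)
    qed
    finally show ?thesis .
  qed
  have car: "mat_adjoint (cols_mat n e) * cols_mat n e \<in> carrier_mat n n"
    by (intro mult_carrier_mat[of _ n n] mat_adjoint_carrier) auto
  show ?thesis
  proof
    assume "unitary_mat n (cols_mat n e)"
    then have "mat_adjoint (cols_mat n e) * cols_mat n e = 1\<^sub>m n"
      by (simp add: unitary_mat_def)
    then show "orthonormal n {..<n} e"
      unfolding orthonormal_def using ent by auto
  next
    assume "orthonormal n {..<n} e"
    then have "mat_adjoint (cols_mat n e) * cols_mat n e = 1\<^sub>m n"
      using car by (intro eq_matI) (auto simp: ent orthonormalD)
    then show "unitary_mat n (cols_mat n e)" by (simp add: unitary_mat_def)
  qed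
qed

lemma unitary_mat_cols:
  assumes "unitary_mat n U"
  obtains e where "orthonormal n {..<n} e" "U = cols_mat n e"
proof
  show U: "U = cols_mat n (\<lambda>a r. U $$ (r,a))"
    using assms by (intro eq_matI) (auto simp: unitary_mat_def cols_mat_def)
  show "orthonormal n {..<n} (\<lambda>a r. U $$ (r,a))"
    using assms U unitary_cols_mat_iff by metis
qed

lemma spec_mat_eq: "cols_mat n e * real_diag n d * mat_adjoint (cols_mat n e) = spec_mat n e d"
proof (rule eq_matI)
  fix r s assume "r < dim_row (spec_mat n e d)" "s < dim_col (spec_mat n e d)"
  then have rs: "r < n" "s < n" by (auto simp: spec_mat_def)
  have UD: "cols_mat n e * real_diag n d \<in> carrier_mat n n"
    by (rule mult_carrier_mat[of _ n n]) auto
  have ent: "(cols_mat n e * real_diag n d) $$ (r,a) = e a r * of_real (d a)" if "a < n" for a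
  proof -
    have "(cols_mat n e * real_diag n d) $$ (r,a) = (\<Sum>k<n. cols_mat n e $$ (r,k) * real_diag n d $$ (k,a))"
      by (rule index_mult_carrier[of _ n n _ n]) (use rs that in auto)
    also have "\<dots> = (\<Sum>k<n. if k = a then e a r * of_real (d a) else 0)"
      using rs that by (intro sum.cong refl) (auto simp: cols_mat_def real_diag_def)
    finally show ?thesis using that by simp
  qed
  have "(cols_mat n e * real_diag n d * mat_adjoint (cols_mat n e)) $$ (r,s)
    = (\<Sum>a<n. (cols_mat n e * real_diag n d) $$ (r,a) * mat_adjoint (cols_mat n e) $$ (a,s))"
    by (rule index_mult_carrier[OF UD, of _ n]) (use rs in auto)
  also have "\<dots> = spec_mat n e d $$ (r,s)"
    unfolding index_spec_mat[OF rs] specf_def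
  proof (intro sum.cong refl)
    fix a assume "a \<in> {..<n}"
    then show "(cols_mat n e * real_diag n d) $$ (r,a) * mat_adjoint (cols_mat n e) $$ (a,s)
      = complex_of_real (d a) * e a r * cnj (e a s)"
      using ent[of a] rs index_mat_adjoint[of "cols_mat n e" n n a s] by (simp add: cols_mat_def)
  qed
  finally show "(cols_mat n e * real_diag n d * mat_adjoint (cols_mat n e)) $$ (r,s) = spec_mat n e d $$ (r,s)" .
qed (auto simp: spec_mat_def cols_mat_def mat_adjoint_def mat_of_rows_def)

text \<open>Makes the description in \<open>mat_fun\<close> well defined. The inner product of
  \<open>e' b\<close> and \<open>e a\<close> vanishes unless \<open>d a = d' b\<close>, so
  \<open>f (d a)\<close> and \<open>f (d' b)\<close> are interchangeable as its
  coefficients.\<close>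

lemma spec_mat_fun_unique:
  assumes e: "orthonormal n {..<n} e" and e': "orthonormal n {..<n} e'"
    and eq: "spec_mat n e d = spec_mat n e' d'"
  shows "spec_mat n e (\<lambda>i. f (d i)) = spec_mat n e' (\<lambda>i. f (d' i))"
proof (rule eq_matI)
  fix r s assume "r < dim_row (spec_mat n e' (\<lambda>i. f (d' i)))" "s < dim_col (spec_mat n e' (\<lambda>i. f (d' i)))"
  then have rs: "r < n" "s < n" by (auto simp: spec_mat_def)
  let ?S = "specf n e (\<lambda>a. complex_of_real (d a))" and ?S' = "specf n e' (\<lambda>a. complex_of_real (d' a))"
  have SS': "?S r s = ?S' r s" if "r < n" "s < n" for r s
    using eq that by (metis index_spec_mat)
  have intertwine: "of_real (f (d' b)) * cip n (e' b) (e a) = of_real (f (d a)) * cip n (e' b) (e a)"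
    if "a < n" "b < n" for a b
  proof -
    have "cip n (e' b) (mv n ?S (e a)) = of_real (d a) * cip n (e' b) (e a)"
      unfolding mv_specf_eigenvector[OF e that(1), abs_def] cip_scale_right ..
    moreover have "cip n (e' b) (mv n ?S' (e a)) = of_real (d' b) * cip n (e' b) (e a)"
    proof -
      have "cip n (e' b) (mv n ?S' (e a)) = (\<Sum>c<n. of_real (d' c) * cip n (e' b) (e' c) * cip n (e' c) (e a))"
        by (rule cip_specf)
      also have "\<dots> = (\<Sum>c<n. if c = b then of_real (d' b) * cip n (e' b) (e a) else 0)"
        using that by (intro sum.cong refl) (auto simp: orthonormalD[OF e'])
      finally show ?thesis using that by simp
    qed
    moreover have "cip n (e' b) (mv n ?S (e a)) = cip n (e' b) (mv n ?S' (e a))"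
      using SS' by (intro cip_cong refl) (simp add: mv_def)
    ultimately show ?thesis by auto
  qed
  have "specf n e (\<lambda>a. complex_of_real (f (d a))) r s
    = (\<Sum>a<n. of_real (f (d a)) * e a r * cnj (e a s))"
    by (simp add: specf_def)
  also have "\<dots> = (\<Sum>a<n. mv n (specf n e' (\<lambda>a. complex_of_real (f (d' a)))) (e a) r * cnj (e a s))"
  proof (intro sum.cong refl)
    fix a assume "a \<in> {..<n}"
    then have a: "a < n" by simp
    have "mv n (specf n e' (\<lambda>a. complex_of_real (f (d' a)))) (e a) r
      = (\<Sum>b<n. of_real (f (d a)) * (cip n (e' b) (e a) * e' b r))"
      unfolding mv_specf using intertwine[OF a] by (intro sum.cong refl) (simp add: mult.assoc[symmetric])
    also have "\<dots> = of_real (f (d a)) * e a r"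
      unfolding sum_distrib_left[symmetric] orthonormal_expand[OF e' rs(1)] ..
    finally show "of_real (f (d a)) * e a r * cnj (e a s)
      = mv n (specf n e' (\<lambda>a. complex_of_real (f (d' a)))) (e a) r * cnj (e a s)" by simp
  qed
  also have "\<dots> = specf n e' (\<lambda>a. complex_of_real (f (d' a))) r s"
    by (rule entry_orthonormal_expand[OF e rs(2)])
  finally show "spec_mat n e (\<lambda>i. f (d i)) $$ (r,s) = spec_mat n e' (\<lambda>i. f (d' i)) $$ (r,s)"
    unfolding index_spec_mat[OF rs] .
qed (auto simp: spec_mat_def)

lemma mat_fun_spec_mat:
  assumes e: "orthonormal n {..<n} e"
  shows "mat_fun n f (spec_mat n e d) = spec_mat n e (\<lambda>i. f (d i))"
  unfolding mat_fun_def
proof (rule the_equality)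
  show "\<exists>U d'. unitary_mat n U \<and> spec_mat n e d = U * real_diag n d' * mat_adjoint U \<and>
      spec_mat n e (\<lambda>i. f (d i)) = U * real_diag n (\<lambda>i. f (d' i)) * mat_adjoint U"
    using e by (intro exI[of _ "cols_mat n e"] exI[of _ d]) (simp add: spec_mat_eq unitary_cols_mat_iff)
next
  fix B assume "\<exists>U d'. unitary_mat n U \<and> spec_mat n e d = U * real_diag n d' * mat_adjoint U \<and>
      B = U * real_diag n (\<lambda>i. f (d' i)) * mat_adjoint U"
  then obtain U d' where U: "unitary_mat n U" "spec_mat n e d = U * real_diag n d' * mat_adjoint U"
    "B = U * real_diag n (\<lambda>i. f (d' i)) * mat_adjoint U" by blast
  obtain e' where e': "orthonormal n {..<n} e'" "U = cols_mat n e'"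
    using unitary_mat_cols[OF U(1)] .
  show "B = spec_mat n e (\<lambda>i. f (d i))"
    using spec_mat_fun_unique[OF e e'(1), of d d' f] U(2,3) unfolding e'(2) spec_mat_eq by simp
qed

section \<open>Symmetric norms of diagonal matrices\<close>

lemma unitary_mat_adjoint:
  assumes "unitary_mat n U"
  shows "unitary_mat n (mat_adjoint U)"
proof -
  have U: "U \<in> carrier_mat n n" "mat_adjoint U * U = 1\<^sub>m n" using assms by (auto simp: unitary_mat_def)
  have "mat_adjoint (mat_adjoint U) = U"
    by (rule eq_matI) (use U(1) index_mat_adjoint[OF U(1)] index_mat_adjoint[OF mat_adjoint_carrier[OF U(1)]]
        in \<open>auto simp: mat_adjoint_def\<close>)
  moreover have "U * mat_adjoint U = 1\<^sub>m n"
    using mat_mult_left_right_inverse[OF mat_adjoint_carrier[OF U(1)] U(1) U(2)] .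
  ultimately show ?thesis using U(1) by (simp add: unitary_mat_def)
qed

lemma symmetric_norm_spec_mat:
  assumes "symmetric_norm n N" "orthonormal n {..<n} e"
  shows "N (spec_mat n e d) = N (real_diag n d)"
proof -
  have U: "unitary_mat n (cols_mat n e)" using assms(2) by (simp add: unitary_cols_mat_iff)
  show ?thesis
    using assms(1) U unitary_mat_adjoint[OF U] real_diag_carrier[of n d]
    unfolding symmetric_norm_def spec_mat_eq[symmetric] by blast
qed

text \<open>On real diagonal matrices the norm is a symmetric gauge: exchanging two entries is a
  unitary conjugation, and changing a sign is multiplication by a diagonal unitary.\<close>

lemma symmetric_norm_weak_majorization:
  assumes N: "symmetric_norm n N"
    and dec: "\<And>i j. i \<le> j \<Longrightarrow> j < n \<Longrightarrow> a j \<le> a i" and nonneg: "\<And>i. i < n \<Longrightarrow> 0 \<le> a i"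
    and sums: "\<And>k. k \<le> n \<Longrightarrow> (\<Sum>i<k. a i) \<le> (\<Sum>i<k. c i)"
  shows "N (real_diag n a) \<le> N (real_diag n c)"
proof (rule symmetric_gauge_weak_majorization[where n = n and \<Phi> = "\<lambda>x. N (real_diag n x)"])
  show "N (real_diag n x) = N (real_diag n y)" if "\<And>i. i < n \<Longrightarrow> x i = y i" for x y
  proof -
    have "real_diag n x = real_diag n y"
      using that by (intro eq_matI) (auto simp: real_diag_def)
    then show ?thesis by simp
  qed
  show "N (real_diag n (\<lambda>i. x i + y i)) \<le> N (real_diag n x) + N (real_diag n y)" for x y
  proof -
    have "real_diag n (\<lambda>i. x i + y i) = real_diag n x + real_diag n y"
      by (rule eq_matI) (auto simp: real_diag_def)
    then show ?thesis using N by (simp add: symmetric_norm_def)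
  qed
  show "N (real_diag n (\<lambda>i. t * x i)) = \<bar>t\<bar> * N (real_diag n x)" for t x
  proof -
    have "real_diag n (\<lambda>i. t * x i) = complex_of_real t \<cdot>\<^sub>m real_diag n x"
      by (rule eq_matI) (auto simp: real_diag_def)
    then show ?thesis using N by (simp add: symmetric_norm_def)
  qed
  show "N (real_diag n (\<lambda>i. x (Transposition.transpose p q i))) = N (real_diag n x)"
    if pq: "p < n" "q < n" for x p q
  proof -
    let ?\<tau> = "Transposition.transpose p q"
    \<comment> \<open>The columns of the permutation matrix of the transposition.\<close>
    let ?e = "\<lambda>a r. if r = ?\<tau> a then 1 else (0::complex)"
    have lt: "?\<tau> a < n \<longleftrightarrow> a < n" for a
      using pq by (auto simp: Transposition.transpose_def)
    have e: "orthonormal n {..<n} ?e"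
      unfolding orthonormal_def
    proof (intro ballI)
      fix a b assume ab: "a \<in> {..<n}" "b \<in> {..<n}"
      have "cip n (?e a) (?e b) = (\<Sum>i<n. if i = ?\<tau> a then (if ?\<tau> a = ?\<tau> b then 1 else 0) else 0)"
        unfolding cip_def by (intro sum.cong refl) auto
      also have "\<dots> = (if ?\<tau> a = ?\<tau> b then 1 else 0)"
        using ab lt by simp
      also have "\<dots> = (if a = b then 1 else 0)"
        by (metis transpose_involutory)
      finally show "cip n (?e a) (?e b) = (if a = b then 1 else 0)" .
    qed
    have "real_diag n (\<lambda>i. x (?\<tau> i)) = spec_mat n ?e x"
    proof (rule eq_matI)
      fix r s assume "r < dim_row (spec_mat n ?e x)" "s < dim_col (spec_mat n ?e x)"
      then have rs: "r < n" "s < n" by (auto simp: spec_mat_def)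
      have "specf n ?e (\<lambda>a. complex_of_real (x a)) r s
        = (\<Sum>a<n. if a = ?\<tau> r then (if r = s then of_real (x (?\<tau> r)) else 0) else 0)"
        unfolding specf_def
      proof (intro sum.cong refl)
        fix a
        have "(r = ?\<tau> a) = (a = ?\<tau> r)" "(s = ?\<tau> a) = (a = ?\<tau> s)"
          by (metis transpose_involutory)+
        moreover have "(?\<tau> r = ?\<tau> s) = (r = s)" by (metis transpose_involutory)
        ultimately show "complex_of_real (x a) * ?e a r * cnj (?e a s)
          = (if a = ?\<tau> r then (if r = s then of_real (x (?\<tau> r)) else 0) else 0)" by auto
      qed
      also have "\<dots> = real_diag n (\<lambda>i. x (?\<tau> i)) $$ (r,s)"
        using rs lt by (simp add: real_diag_def)
      finally show "real_diag n (\<lambda>i. x (?\<tau> i)) $$ (r,s) = spec_mat n ?e x $$ (r,s)"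
        unfolding index_spec_mat[OF rs] by simp
    qed (auto simp: spec_mat_def real_diag_def)
    then show ?thesis using symmetric_norm_spec_mat[OF N e, of x] by simp
  qed
  show "N (real_diag n (x(p := - x p))) = N (real_diag n x)" if "p < n" for x p
  proof -
    let ?s = "\<lambda>i. if i = p then - 1 else (1::real)"
    have mult: "real_diag n y * real_diag n z = real_diag n (\<lambda>i. y i * z i)" for y z
    proof (rule eq_matI)
      fix i j assume "i < dim_row (real_diag n (\<lambda>i. y i * z i))" "j < dim_col (real_diag n (\<lambda>i. y i * z i))"
      then have ij: "i < n" "j < n" by (auto simp: real_diag_def)
      have "(real_diag n y * real_diag n z) $$ (i,j)
        = (\<Sum>k<n. real_diag n y $$ (i,k) * real_diag n z $$ (k,j))"
        by (rule index_mult_carrier[of _ n n _ n]) (use ij in auto)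
      also have "\<dots> = (\<Sum>k<n. if k = i then (if i = j then of_real (y i * z i) else 0) else 0)"
        using ij by (intro sum.cong refl) (auto simp: real_diag_def)
      finally show "(real_diag n y * real_diag n z) $$ (i,j) = real_diag n (\<lambda>i. y i * z i) $$ (i,j)"
        using ij by (simp add: real_diag_def)
    qed (auto simp: real_diag_def)
    have one: "1\<^sub>m n = real_diag n (\<lambda>_. 1)"
      by (rule eq_matI) (auto simp: real_diag_def)
    have adj: "mat_adjoint (real_diag n y) = real_diag n y" for y
    proof (rule eq_matI)
      fix i j assume "i < dim_row (real_diag n y)" "j < dim_col (real_diag n y)"
      then show "mat_adjoint (real_diag n y) $$ (i,j) = real_diag n y $$ (i,j)"
        using index_mat_adjoint[of "real_diag n y" n n i j] by (auto simp: real_diag_def)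
    qed (simp_all add: real_diag_def mat_adjoint_def)
    have "(\<lambda>i. ?s i * ?s i) = (\<lambda>_. 1)" by auto
    then have "unitary_mat n (real_diag n ?s)"
      by (simp only: unitary_mat_def adj mult one real_diag_carrier simp_thms)
    moreover have "unitary_mat n (1\<^sub>m n)"
      unfolding one by (simp add: unitary_mat_def adj mult) (simp add: one)
    ultimately have "N (real_diag n ?s * real_diag n x * 1\<^sub>m n) = N (real_diag n x)"
      using N real_diag_carrier[of n x] unfolding symmetric_norm_def by blast
    moreover have "(\<lambda>i. ?s i * x i * 1) = x(p := - x p)" by auto
    ultimately show ?thesis
      unfolding one mult by (simp only:)
  qed
qed (use assms in auto)

section \<open>Absolute values of matrices\<close>

lemma mat_abs_normal:
  assumes A: "A \<in> carrier_mat n n" and e: "orthonormal n {..<n} e"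
    and spec: "\<And>r s. r < n \<Longrightarrow> s < n \<Longrightarrow> A $$ (r,s) = specf n e \<alpha> r s"
  shows "mat_abs n A = spec_mat n e (\<lambda>a. cmod (\<alpha> a))"
proof -
  have "mat_adjoint A * A = spec_mat n e (\<lambda>a. (cmod (\<alpha> a))\<^sup>2)"
  proof (rule eq_matI)
    fix r s assume "r < dim_row (spec_mat n e (\<lambda>a. (cmod (\<alpha> a))\<^sup>2))"
      "s < dim_col (spec_mat n e (\<lambda>a. (cmod (\<alpha> a))\<^sup>2))"
    then have rs: "r < n" "s < n" by (auto simp: spec_mat_def)
    define z where "z = (\<lambda>s a. \<alpha> a * cnj (e a s))"
    have "(mat_adjoint A * A) $$ (r,s) = (\<Sum>t<n. mat_adjoint A $$ (r,t) * A $$ (t,s))"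
      by (rule index_mult_carrier[OF mat_adjoint_carrier[OF A] A rs])
    also have "\<dots> = cip n (\<lambda>t. \<Sum>a<n. z r a * e a t) (\<lambda>t. \<Sum>a<n. z s a * e a t)"
      unfolding cip_def
    proof (intro sum.cong refl)
      fix t assume "t \<in> {..<n}"
      then show "mat_adjoint A $$ (r,t) * A $$ (t,s)
        = cnj (\<Sum>a<n. z r a * e a t) * (\<Sum>a<n. z s a * e a t)"
        using rs index_mat_adjoint[OF A rs(1), of t] spec[of t r] spec[of t s]
        by (simp add: specf_def z_def mult.commute mult.left_commute)
    qed
    also have "\<dots> = (\<Sum>a<n. cnj (z r a) * z s a)"
      unfolding cip_sum_left
      by (intro sum.cong refl) (subst orthonormal_cip_sum[OF e], auto)
    also have "\<dots> = specf n e (\<lambda>a. of_real ((cmod (\<alpha> a))\<^sup>2)) r s"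
      unfolding specf_def cnj_mult_self[symmetric] z_def by (simp add: algebra_simps)
    finally show "(mat_adjoint A * A) $$ (r,s) = spec_mat n e (\<lambda>a. (cmod (\<alpha> a))\<^sup>2) $$ (r,s)"
      unfolding index_spec_mat[OF rs] .
  qed (use A in \<open>auto simp: spec_mat_def mat_adjoint_def\<close>)
  then show ?thesis
    unfolding mat_abs_def by (simp add: mat_fun_spec_mat[OF e])
qed

text \<open>Diagonalizing X* X yields right singular vectors and singular values. Orthogonality of
  the images of \<open>v\<close> encodes the decomposition and makes sense for zero singular values
  too.\<close>

lemma mat_abs_spectral:
  assumes X: "X \<in> carrier_mat n n"
  obtains v \<sigma> where "orthonormal n {..<n} v" "mat_abs n X = spec_mat n v \<sigma>"
    "\<And>i j. i \<le> j \<Longrightarrow> j < n \<Longrightarrow> \<sigma> j \<le> \<sigma> i" "\<And>i. i < n \<Longrightarrow> 0 \<le> \<sigma> i"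
    "\<And>i j. i < n \<Longrightarrow> j < n \<Longrightarrow> cip n (mv n (mat_entry X) (v i)) (mv n (mat_entry X) (v j))
      = (if i = j then of_real ((\<sigma> i)\<^sup>2) else 0)"
proof -
  define H where "H = (\<lambda>r s. \<Sum>t<n. cnj (X $$ (t,r)) * X $$ (t,s))"
  have "H r s = cnj (H s r)" for r s by (simp add: H_def mult.commute)
  from hermitian_spectral[of n H, OF this] obtain v \<mu> where v: "orthonormal n {..<n} v"
    and dec: "\<forall>a b. a \<le> b \<longrightarrow> b < n \<longrightarrow> \<mu> b \<le> \<mu> a"
    and H: "\<forall>r<n. \<forall>s<n. H r s = specf n v (\<lambda>a. complex_of_real (\<mu> a)) r s" by blast
  have sv: "cip n (mv n (mat_entry X) (v i)) (mv n (mat_entry X) (v j)) = (if i = j then of_real (\<mu> i) else 0)"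
    if "i < n" "j < n" for i j
  proof -
    have "cip n (mv n (mat_entry X) (v i)) (mv n (mat_entry X) (v j)) = cip n (v i) (mv n (adj (mat_entry X)) (mv n (mat_entry X) (v j)))"
      by (rule cip_mv_left)
    also have "\<dots> = cip n (v i) (mv n (specf n v (\<lambda>a. complex_of_real (\<mu> a))) (v j))"
    proof (intro cip_cong refl)
      fix r assume "r < n"
      then have "H r s = specf n v (\<lambda>a. complex_of_real (\<mu> a)) r s" if "s < n" for s
        using H that by blast
      then show "mv n (adj (mat_entry X)) (mv n (mat_entry X) (v j)) r
        = mv n (specf n v (\<lambda>a. complex_of_real (\<mu> a))) (v j) r"
        unfolding mv_mv by (simp add: mv_def adj_def mat_entry_def H_def)
    qed
    also have "\<dots> = (if i = j then of_real (\<mu> i) else 0)"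
      unfolding mv_specf_eigenvector[OF v that(2), abs_def] cip_scale_right
      using that by (simp add: orthonormalD[OF v])
    finally show ?thesis .
  qed
  have \<mu>0: "0 \<le> \<mu> i" if "i < n" for i
    using sv[OF that that] sqn_nonneg[of n "mv n (mat_entry X) (v i)"] by (simp add: cip_self)
  have "mat_adjoint X * X = spec_mat n v \<mu>"
  proof (rule eq_matI)
    fix r s assume "r < dim_row (spec_mat n v \<mu>)" "s < dim_col (spec_mat n v \<mu>)"
    then have rs: "r < n" "s < n" by (auto simp: spec_mat_def)
    have "(mat_adjoint X * X) $$ (r,s) = H r s"
      unfolding index_mult_carrier[OF mat_adjoint_carrier[OF X] X rs] H_def
      using rs index_mat_adjoint[OF X] by (intro sum.cong) auto
    then show "(mat_adjoint X * X) $$ (r,s) = spec_mat n v \<mu> $$ (r,s)"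
      using H rs by (simp add: index_spec_mat)
  qed (use X in \<open>auto simp: spec_mat_def mat_adjoint_def\<close>)
  then have "mat_abs n X = spec_mat n v (\<lambda>i. sqrt (\<mu> i))"
    unfolding mat_abs_def by (simp add: mat_fun_spec_mat[OF v])
  then show ?thesis
    using v dec \<mu>0 sv by (intro that[of v "\<lambda>i. sqrt (\<mu> i)"]) auto
qed

text \<open>A congruence keeps the coefficients of a sum of terms e e^* and replaces each vector e
  by Z* e.\<close>

lemma index_congruence:
  assumes Z: "Z \<in> carrier_mat n n" and M: "M \<in> carrier_mat n n"
    and spec: "\<And>r s. r < n \<Longrightarrow> s < n \<Longrightarrow> M $$ (r,s) = specf n e \<alpha> r s" and rs: "r < n" "s < n"
  shows "(mat_adjoint Z * M * Z) $$ (r,s) = specf n (\<lambda>a. mv n (adj (mat_entry Z)) (e a)) \<alpha> r s"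
proof -
  have ZM: "mat_adjoint Z * M \<in> carrier_mat n n"
    using mult_carrier_mat[OF mat_adjoint_carrier[OF Z] M] .
  have ent: "(mat_adjoint Z * M) $$ (r,u) = (\<Sum>a<n. \<alpha> a * mv n (adj (mat_entry Z)) (e a) r * cnj (e a u))"
    if "u < n" for u
  proof -
    have "(mat_adjoint Z * M) $$ (r,u) = (\<Sum>t<n. mat_adjoint Z $$ (r,t) * M $$ (t,u))"
      by (rule index_mult_carrier[OF mat_adjoint_carrier[OF Z] M rs(1) that])
    also have "\<dots> = (\<Sum>t<n. cnj (Z $$ (t,r)) * (\<Sum>a<n. \<alpha> a * e a t * cnj (e a u)))"
      using rs that index_mat_adjoint[OF Z rs(1)] spec by (intro sum.cong refl) (simp add: specf_def)
    also have "\<dots> = (\<Sum>a<n. \<alpha> a * mv n (adj (mat_entry Z)) (e a) r * cnj (e a u))"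
      unfolding mv_def adj_def mat_entry_def sum_distrib_left sum_distrib_right
      by (subst sum.swap) (simp add: algebra_simps)
    finally show ?thesis .
  qed
  have "(mat_adjoint Z * M * Z) $$ (r,s) = (\<Sum>u<n. (mat_adjoint Z * M) $$ (r,u) * Z $$ (u,s))"
    by (rule index_mult_carrier[OF ZM Z rs])
  also have "\<dots> = (\<Sum>u<n. (\<Sum>a<n. \<alpha> a * mv n (adj (mat_entry Z)) (e a) r * cnj (e a u)) * Z $$ (u,s))"
    using ent by (intro sum.cong) auto
  also have "\<dots> = (\<Sum>a<n. \<alpha> a * mv n (adj (mat_entry Z)) (e a) r * (\<Sum>u<n. cnj (e a u) * Z $$ (u,s)))"
    unfolding sum_distrib_left sum_distrib_right by (subst sum.swap) (simp add: mult.assoc)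
  also have "\<dots> = specf n (\<lambda>a. mv n (adj (mat_entry Z)) (e a)) \<alpha> r s"
    unfolding specf_def by (intro sum.cong refl) (simp add: mv_def adj_def mat_entry_def mult.commute)
  finally show ?thesis .
qed

section \<open>Sums over all summands and eigenvectors\<close>

lemma mat_sum_carrier:
  "(\<And>i. i < m \<Longrightarrow> F i \<in> carrier_mat n n) \<Longrightarrow> mat_sum n F m \<in> carrier_mat n n"
  by (induction m) auto

lemma index_mat_sum:
  "(\<And>i. i < m \<Longrightarrow> F i \<in> carrier_mat n n) \<Longrightarrow> r < n \<Longrightarrow> s < n \<Longrightarrow>
    mat_sum n F m $$ (r,s) = (\<Sum>i<m. F i $$ (r,s))"
proof (induction m)
  case (Suc m)
  then have "F m \<in> carrier_mat n n" by simp
  then have "dim_row (F m) = n" "dim_col (F m) = n" by auto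
  then show ?case using Suc by simp
qed simp

text \<open>The pair of \<open>i\<close> and \<open>a < n\<close> is coded as
  \<open>i * n + a\<close>; thus the vectors of all summands form a single family.\<close>

lemma sum_div_mod:
  fixes F :: "nat \<Rightarrow> nat \<Rightarrow> 'a :: comm_monoid_add"
  shows "(\<Sum>j<m * n. F (j div n) (j mod n)) = (\<Sum>i<m. \<Sum>a<n. F i a)"
proof (induction m)
  case (Suc m)
  have "(\<Sum>j<Suc m * n. F (j div n) (j mod n))
    = (\<Sum>j<m * n. F (j div n) (j mod n)) + (\<Sum>j\<in>{m * n..<m * n + n}. F (j div n) (j mod n))"
    by (subst sum.union_disjoint[symmetric]) (auto intro!: sum.cong)
  also have "(\<Sum>j\<in>{m * n..<m * n + n}. F (j div n) (j mod n)) = (\<Sum>a<n. F m a)"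
  proof -
    have "(\<Sum>j\<in>{m * n..<m * n + n}. F (j div n) (j mod n)) = (\<Sum>a\<in>{0..<n}. F ((a + m * n) div n) ((a + m * n) mod n))"
      using sum.shift_bounds_nat_ivl[of "\<lambda>j. F (j div n) (j mod n)" 0 "m * n" n]
      by (simp add: add.commute)
    also have "\<dots> = (\<Sum>a<n. F m a)"
      by (intro sum.cong) auto
    finally show ?thesis .
  qed
  finally show ?case using Suc by simp
qed simp

section \<open>Expansive matrices and their adjoints\<close>

lemma expansive_sqn_le:
  assumes Z: "Z \<in> carrier_mat n n" and ge: "loewner_le n (1\<^sub>m n) (mat_adjoint Z * Z)"
  shows "sqn n x \<le> sqn n (mv n (mat_entry Z) x)"
proof -
  define v where "v = vec n x"
  have v: "v \<in> carrier_vec n" by (simp add: v_def)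
  have ZZ: "mat_adjoint Z * Z \<in> carrier_mat n n"
    using mult_carrier_mat[OF mat_adjoint_carrier[OF Z] Z] .
  have "0 \<le> Re (conjugate v \<bullet> ((mat_adjoint Z * Z - 1\<^sub>m n) *\<^sub>v v))"
    using ge v by (simp add: loewner_le_def psd_mat_def)
  also have "conjugate v \<bullet> ((mat_adjoint Z * Z - 1\<^sub>m n) *\<^sub>v v)
    = cip n x (\<lambda>r. mv n (adj (mat_entry Z)) (mv n (mat_entry Z) x) r - x r)"
  proof -
    have "((mat_adjoint Z * Z - 1\<^sub>m n) *\<^sub>v v) $ r = mv n (adj (mat_entry Z)) (mv n (mat_entry Z) x) r - x r"
      if r: "r < n" for r
    proof -
      have "((mat_adjoint Z * Z - 1\<^sub>m n) *\<^sub>v v) $ r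
        = (\<Sum>s<n. ((mat_adjoint Z * Z) $$ (r,s) - (if r = s then 1 else 0)) * x s)"
        using r ZZ Z by (auto simp: scalar_prod_def atLeast0LessThan v_def mat_adjoint_def intro!: sum.cong)
      also have "\<dots> = (\<Sum>s<n. (mat_adjoint Z * Z) $$ (r,s) * x s) - (\<Sum>s<n. if s = r then x s else 0)"
        unfolding sum_subtractf[symmetric] by (intro sum.cong refl) (simp add: algebra_simps)
      also have "(\<Sum>s<n. if s = r then x s else 0) = x r" using r by simp
      also have "(\<Sum>s<n. (mat_adjoint Z * Z) $$ (r,s) * x s) = mv n (adj (mat_entry Z)) (mv n (mat_entry Z) x) r"
        unfolding mv_mv
      proof (intro sum.cong refl)
        fix s assume "s \<in> {..<n}"
        then have s: "s < n" by simp
        have "(mat_adjoint Z * Z) $$ (r,s) = (\<Sum>t<n. adj (mat_entry Z) r t * mat_entry Z t s)"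
          unfolding index_mult_carrier[OF mat_adjoint_carrier[OF Z] Z r s]
          using index_mat_adjoint[OF Z r] by (intro sum.cong refl) (simp add: adj_def mat_entry_def)
        then show "(mat_adjoint Z * Z) $$ (r,s) * x s = (\<Sum>t<n. adj (mat_entry Z) r t * mat_entry Z t s) * x s" by simp
      qed
      finally show ?thesis .
    qed
    then show ?thesis
      using ZZ Z by (simp add: scalar_prod_def cip_def atLeast0LessThan v_def mat_adjoint_def)
  qed
  also have "\<dots> = cip n (mv n (mat_entry Z) x) (mv n (mat_entry Z) x) - cip n x x"
    unfolding cip_diff_right cip_mv_left ..
  finally show ?thesis by simp
qed

text \<open>An expansive matrix is injective, hence onto in finite dimension. So Z x = e for some
  \<open>x\<close> with |x| \<le> 1, and 1 = <Z* e, x> \<le> |Z* e| |x|.\<close>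

lemma expansive_adj_sqn_ge:
  assumes Z: "\<And>x. sqn n x \<le> sqn n (mv n Z x)" and e: "sqn n e = 1"
  shows "1 \<le> sqn n (mv n (adj Z) e)"
proof -
  \<comment> \<open>\<open>n\<close> equations in \<open>n + 1\<close> unknowns. The last unknown is
    the coefficient of \<open>- e\<close>; it is nonzero by injectivity, so one can divide by
    it.\<close>
  obtain c where c: "\<exists>i<Suc n. c i \<noteq> 0"
    "\<forall>r<n. (\<Sum>i<Suc n. (if i < n then Z r i else - e r) * c i) = 0"
    using homogeneous_system_solution[of n "Suc n" "\<lambda>r i. if i < n then Z r i else - e r"] by auto
  have eq: "mv n Z c r = e r * c n" if "r < n" for r
    using c(2) that by (simp add: mv_def)
  have "c n \<noteq> 0"
  proof
    assume 0: "c n = 0"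
    then have "sqn n (mv n Z c) = 0" using eq by (simp add: sqn_zero_iff)
    then have "sqn n c = 0" using Z[of c] sqn_nonneg[of n c] by linarith
    then show False using c(1) 0 by (auto simp: sqn_zero_iff less_Suc_eq)
  qed
  define x where "x = (\<lambda>i. (1 / c n) * c i)"
  have Zx: "mv n Z x r = e r" if "r < n" for r
  proof -
    have "mv n Z x r = (1 / c n) * mv n Z c r"
      by (simp add: mv_def x_def sum_divide_distrib)
    then show ?thesis using eq[OF that] \<open>c n \<noteq> 0\<close> by simp
  qed
  have "cip n (mv n (adj Z) e) x = cip n e e"
    unfolding cip_mv_right[symmetric] using Zx by (intro cip_cong) auto
  then have "1 \<le> sqn n (mv n (adj Z) e) * sqn n x"
    using cip_cauchy_schwarz[of n "mv n (adj Z) e" x] e by (simp add: cip_self)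
  also have "\<dots> \<le> sqn n (mv n (adj Z) e) * 1"
    using Z[of x] sqn_cong[of n "mv n Z x" e] Zx e by (intro mult_left_mono) auto
  finally show ?thesis by simp
qed

lemma normal_mat_spectral:
  assumes "normal_mat n A"
  shows "\<exists>e \<alpha>. orthonormal n {..<n} e \<and> (\<forall>r<n. \<forall>s<n. A $$ (r,s) = specf n e \<alpha> r s)"
proof -
  have A: "A \<in> carrier_mat n n" "A * mat_adjoint A = mat_adjoint A * A"
    using assms by (auto simp: normal_mat_def)
  have "(\<Sum>t<n. mat_entry A r t * cnj (mat_entry A s t)) = (\<Sum>t<n. cnj (mat_entry A t r) * mat_entry A t s)"
    if rs: "r < n" "s < n" for r s
  proof -
    have "(A * mat_adjoint A) $$ (r,s) = (\<Sum>t<n. mat_entry A r t * cnj (mat_entry A s t))"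
      unfolding index_mult_carrier[OF A(1) mat_adjoint_carrier[OF A(1)] rs] mat_entry_def
      using rs index_mat_adjoint[OF A(1)] by (intro sum.cong) auto
    moreover have "(mat_adjoint A * A) $$ (r,s) = (\<Sum>t<n. cnj (mat_entry A t r) * mat_entry A t s)"
      unfolding index_mult_carrier[OF mat_adjoint_carrier[OF A(1)] A(1) rs] mat_entry_def
      using rs index_mat_adjoint[OF A(1)] by (intro sum.cong) auto
    ultimately show ?thesis using A(2) by simp
  qed
  from normal_spectral[of n "mat_entry A", OF this] show ?thesis
    by (simp add: mat_entry_def)
qed

lemma cip_specf_real:
  "cip n x (mv n (specf l b (\<lambda>j. complex_of_real (w j))) x) = of_real (\<Sum>j<l. w j * (cmod (cip n (b j) x))\<^sup>2)"
proof -
  have "cip n x (mv n (specf l b (\<lambda>j. complex_of_real (w j))) x)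
    = (\<Sum>j<l. of_real (w j) * (cnj (cip n (b j) x) * cip n (b j) x))"
    unfolding cip_specf cnj_cip by (simp add: mult.assoc)
  then show ?thesis by (simp only: cnj_mult_self of_real_sum of_real_mult)
qed

text \<open>The quadratic form is computed from both expansions of the matrix; at an eigenvector one
  of them collapses to the eigenvalue.\<close>

lemma specf_real_quadratic_form:
  assumes y: "orthonormal n {..<n} y"
    and eq: "\<And>r s. r < n \<Longrightarrow> s < n \<Longrightarrow>
      specf l b (\<lambda>j. complex_of_real (w j)) r s = specf n y (\<lambda>a. complex_of_real (c a)) r s"
  shows "(\<Sum>a<n. c a * (cmod (cip n (y a) x))\<^sup>2) = (\<Sum>j<l. w j * (cmod (cip n (b j) x))\<^sup>2)"
    and "i < n \<Longrightarrow> c i = (\<Sum>j<l. w j * (cmod (cip n (b j) (y i)))\<^sup>2)"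
proof -
  have quad: "(\<Sum>a<n. c a * (cmod (cip n (y a) x))\<^sup>2) = (\<Sum>j<l. w j * (cmod (cip n (b j) x))\<^sup>2)" for x
  proof -
    have "cip n x (mv n (specf l b (\<lambda>j. complex_of_real (w j))) x)
      = cip n x (mv n (specf n y (\<lambda>a. complex_of_real (c a))) x)"
      using eq by (intro cip_cong refl) (simp add: mv_def)
    then show ?thesis by (simp only: cip_specf_real of_real_eq_iff)
  qed
  show "(\<Sum>a<n. c a * (cmod (cip n (y a) x))\<^sup>2) = (\<Sum>j<l. w j * (cmod (cip n (b j) x))\<^sup>2)"
    by (rule quad)
  show "c i = (\<Sum>j<l. w j * (cmod (cip n (b j) (y i)))\<^sup>2)" if "i < n"
  proof -
    have "(\<Sum>a<n. c a * (cmod (cip n (y a) (y i)))\<^sup>2) = (\<Sum>a<n. if a = i then c i else 0)"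
      using that by (intro sum.cong refl) (auto simp: orthonormalD[OF y])
    then show ?thesis using quad[of "y i"] that by simp
  qed
qed

theorem theorem3p3:
  fixes n m :: nat and A Z :: "nat \<Rightarrow> complex mat" and f :: "real \<Rightarrow> real"
    and N :: "complex mat \<Rightarrow> real"
  assumes "m \<ge> 1"
    and "\<And>i. i < m \<Longrightarrow> normal_mat n (A i)"
    and "\<And>i. i < m \<Longrightarrow> Z i \<in> carrier_mat n n"
    and "\<And>i. i < m \<Longrightarrow> loewner_le n (1\<^sub>m n) (mat_adjoint (Z i) * Z i)"
    and "concave_on {0..} f"
    and "\<And>x. 0 \<le> x \<Longrightarrow> 0 \<le> f x"
    and "symmetric_norm n N"
  shows "N (mat_fun n f (mat_abs n (mat_sum n (\<lambda>i. mat_adjoint (Z i) * A i * Z i) m)))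
         \<le> N (mat_sum n (\<lambda>i. mat_adjoint (Z i) * mat_fun n f (mat_abs n (A i)) * Z i) m)"
proof -
  note Zc = assms(3) and f = assms(5,6)
  have mono: "f x \<le> f y" if "0 \<le> x" "x \<le> y" for x y
    by (rule concave_nonneg_mono[OF f that])
  have "\<forall>i. \<exists>e \<alpha>. i < m \<longrightarrow> orthonormal n {..<n} e \<and> (\<forall>r<n. \<forall>s<n. A i $$ (r,s) = specf n e \<alpha> r s)"
    using normal_mat_spectral[OF assms(2)] by blast
  then obtain e \<alpha> where "\<forall>i. i < m \<longrightarrow> orthonormal n {..<n} (e i) \<and>
      (\<forall>r<n. \<forall>s<n. A i $$ (r,s) = specf n (e i) (\<alpha> i) r s)"
    by metis
  then have e: "\<And>i. i < m \<Longrightarrow> orthonormal n {..<n} (e i)"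
    and Ae: "\<And>i r s. i < m \<Longrightarrow> r < n \<Longrightarrow> s < n \<Longrightarrow> A i $$ (r,s) = specf n (e i) (\<alpha> i) r s"
    by auto
  have Ac: "A i \<in> carrier_mat n n" if "i < m" for i
    using assms(2)[OF that] by (simp add: normal_mat_def)
  have fA: "mat_fun n f (mat_abs n (A i)) = spec_mat n (e i) (\<lambda>a. f (cmod (\<alpha> i a)))" if "i < m" for i
    by (simp only: mat_abs_normal[OF Ac[OF that] e[OF that] Ae[OF that]] mat_fun_spec_mat[OF e[OF that]])
  \<comment> \<open>The vectors Z_i^* e_a of all summands in one list, with
    \<open>i = j div n\<close> and \<open>a = j mod n\<close>; \<open>\<omega>\<close> lists the
    eigenvalues in the same order.\<close>
  define b where "b = (\<lambda>j. mv n (adj (mat_entry (Z (j div n)))) (e (j div n) (j mod n)))"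
  define \<omega> where "\<omega> = (\<lambda>j. \<alpha> (j div n) (j mod n))"
  have expansive: "sqn n x \<le> sqn n (mv n (mat_entry (Z i)) x)" if "i < m" for i x
    by (rule expansive_sqn_le[OF Zc[OF that] assms(4)[OF that]])
  have flat: "(\<Sum>i<m. specf n (\<lambda>a. mv n (adj (mat_entry (Z i))) (e i a)) (\<lambda>a. \<phi> (\<alpha> i a)) r s)
    = specf (m * n) b (\<lambda>j. \<phi> (\<omega> j)) r s" for \<phi> r s
    unfolding specf_def b_def \<omega>_def by (rule sum_div_mod[symmetric])
  \<comment> \<open>There are at least \<open>n\<close> vectors \<open>b j\<close>, so each of the
    \<open>n\<close> singular values has an eigenvalue of the averaged Gram matrix to be compared
    with.\<close>
  have nl: "n \<le> m * n" using \<open>m \<ge> 1\<close> by simp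
  have b: "1 \<le> sqn n (b j)" if j: "j < m * n" for j
  proof -
    have n: "n > 0" using j by (cases n) auto
    have i: "j div n < m" "j mod n < n" using j n by (auto simp: less_mult_imp_div_less)
    show ?thesis
      unfolding b_def using orthonormal_sqn[OF e[OF i(1)]] i
      by (intro expansive_adj_sqn_ge expansive) auto
  qed
  define X where "X = mat_sum n (\<lambda>i. mat_adjoint (Z i) * A i * Z i) m"
  define C where "C = mat_sum n (\<lambda>i. mat_adjoint (Z i) * mat_fun n f (mat_abs n (A i)) * Z i) m"
  have carrier: "mat_adjoint (Z i) * M * Z i \<in> carrier_mat n n" if "i < m" "M \<in> carrier_mat n n" for i M
    using Zc[OF that(1)] that(2) by (intro mult_carrier_mat[of _ n n] mat_adjoint_carrier)
  have Xc: "X \<in> carrier_mat n n"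
    unfolding X_def by (intro mat_sum_carrier carrier Ac)
  have Cc: "C \<in> carrier_mat n n"
    unfolding C_def by (intro mat_sum_carrier carrier) (simp_all add: fA)
  have Xs: "mat_entry X r s = specf (m * n) b \<omega> r s" if "r < n" "s < n" for r s
  proof -
    have "mat_entry X r s = (\<Sum>i<m. (mat_adjoint (Z i) * A i * Z i) $$ (r,s))"
      unfolding mat_entry_def X_def by (rule index_mat_sum) (auto intro: carrier Ac that)
    also have "\<dots> = (\<Sum>i<m. specf n (\<lambda>a. mv n (adj (mat_entry (Z i))) (e i a)) (\<alpha> i) r s)"
      using that by (intro sum.cong refl index_congruence Zc Ac Ae) auto
    finally show ?thesis using flat[of "\<lambda>z. z"] by simp
  qed
  have Cs: "C $$ (r,s) = specf (m * n) b (\<lambda>j. complex_of_real (f (cmod (\<omega> j)))) r s" if "r < n" "s < n" for r s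
  proof -
    have "C $$ (r,s) = (\<Sum>i<m. (mat_adjoint (Z i) * mat_fun n f (mat_abs n (A i)) * Z i) $$ (r,s))"
      unfolding C_def by (rule index_mat_sum) (auto intro!: carrier simp: fA that)
    also have "\<dots> = (\<Sum>i<m. specf n (\<lambda>a. mv n (adj (mat_entry (Z i))) (e i a))
        (\<lambda>a. complex_of_real (f (cmod (\<alpha> i a)))) r s)"
      using that by (intro sum.cong refl index_congruence Zc) (auto simp: fA index_spec_mat)
    finally show ?thesis using flat[of "\<lambda>z. complex_of_real (f (cmod z))"] by simp
  qed
  obtain v \<sigma> where v: "orthonormal n {..<n} v" and absX: "mat_abs n X = spec_mat n v \<sigma>"
    and \<sigma>: "\<And>i j. i \<le> j \<Longrightarrow> j < n \<Longrightarrow> \<sigma> j \<le> \<sigma> i" "\<And>i. i < n \<Longrightarrow> 0 \<le> \<sigma> i"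
    and sv: "\<And>i j. i < n \<Longrightarrow> j < n \<Longrightarrow> cip n (mv n (mat_entry X) (v i)) (mv n (mat_entry X) (v j))
      = (if i = j then of_real ((\<sigma> i)\<^sup>2) else 0)"
    using mat_abs_spectral[OF Xc] by metis
  have herm: "specf (m * n) b (\<lambda>j. complex_of_real (w j)) r s = cnj (specf (m * n) b (\<lambda>j. complex_of_real (w j)) s r)"
    for w r s
    by (simp add: specf_def algebra_simps)
  obtain y c where y: "orthonormal n {..<n} y" and c: "\<forall>i j. i \<le> j \<longrightarrow> j < n \<longrightarrow> c j \<le> c i"
    and Cy: "\<forall>r<n. \<forall>s<n. specf (m * n) b (\<lambda>j. complex_of_real (f (cmod (\<omega> j)))) r s
      = specf n y (\<lambda>a. complex_of_real (c a)) r s"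
    using hermitian_spectral[of n "specf (m * n) b (\<lambda>j. complex_of_real (f (cmod (\<omega> j))))", OF herm] by blast
  have CN: "C = spec_mat n y c"
    by (rule eq_matI) (use Cc Cs Cy in \<open>auto simp: spec_mat_def\<close>)
  \<comment> \<open>The inequality for initial sums needs value 0 at 0; monotonicity of
    \<open>f\<close> keeps the difference nonnegative. The constant \<open>f 0\<close> is restored
    through \<open>frame\<close>.\<close>
  define f0 where "f0 = (\<lambda>t. f t - f 0)"
  have f0: "concave_on {0..} f0" "f0 0 = 0" "\<And>t. 0 \<le> t \<Longrightarrow> 0 \<le> f0 t"
    unfolding f0_def using f(1) mono[of 0] by (auto intro!: concave_on_diff simp: convex_on_const)
  obtain x c0 where x: "orthonormal n {..<n} x" and c0: "\<forall>i j. i \<le> j \<longrightarrow> j < n \<longrightarrow> c0 j \<le> c0 i"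
    and Cx: "\<forall>r<n. \<forall>s<n. specf (m * n) b (\<lambda>j. complex_of_real (f0 (cmod (\<omega> j)))) r s
      = specf n x (\<lambda>a. complex_of_real (c0 a)) r s"
    using hermitian_spectral[of n "specf (m * n) b (\<lambda>j. complex_of_real (f0 (cmod (\<omega> j))))", OF herm] by blast
  \<comment> \<open>The sum of all b_j b_j^* dominates the identity: its terms are positive
    semidefinite, and those with \<open>i = 0\<close> add up to Z_0^* Z_0.\<close>
  have frame: "1 \<le> (\<Sum>j<m * n. (cmod (cip n (b j) z))\<^sup>2)" if "sqn n z = 1" for z
  proof -
    have "1 \<le> sqn n (mv n (mat_entry (Z 0)) z)" using expansive[of 0 z] that \<open>m \<ge> 1\<close> by simp
    also have "\<dots> = (\<Sum>a<n. (cmod (cip n (mv n (adj (mat_entry (Z 0))) (e 0 a)) z))\<^sup>2)"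
      using parseval[OF e[of 0], of "mv n (mat_entry (Z 0)) z"] \<open>m \<ge> 1\<close> by (simp add: cip_mv_right)
    also have "\<dots> \<le> (\<Sum>i<m. \<Sum>a<n. (cmod (cip n (mv n (adj (mat_entry (Z i))) (e i a)) z))\<^sup>2)"
      using \<open>m \<ge> 1\<close> by (intro member_le_sum[of 0 "{..<m}"]) (auto intro: sum_nonneg)
    also have "\<dots> = (\<Sum>j<m * n. (cmod (cip n (b j) z))\<^sup>2)"
      unfolding b_def by (rule sum_div_mod[symmetric])
    finally show ?thesis .
  qed
  have sums: "(\<Sum>i<k. f (\<sigma> i)) \<le> (\<Sum>i<k. c i)" if k: "k \<le> n" for k
  proof -
    have "(\<Sum>i<k. f0 (\<sigma> i)) \<le> (\<Sum>i<k. c0 i)"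
    proof (rule concave_singular_value_sum_le[OF f0 b nl v _ \<sigma> x _ _ k])
      show "cip n (mv n (specf (m * n) b \<omega>) (v i)) (mv n (specf (m * n) b \<omega>) (v j))
        = (if i = j then of_real ((\<sigma> i)\<^sup>2) else 0)" if "i < n" "j < n" for i j
        unfolding sv[OF that, symmetric] using Xs by (intro cip_cong) (simp_all add: mv_def)
    qed (use Cx c0 in auto)
    then have "(\<Sum>i<k. f (\<sigma> i)) \<le> (\<Sum>i<k. c0 i + f 0)"
      by (simp add: f0_def sum_subtractf sum.distrib)
    \<comment> \<open>\<open>C\<close> is the matrix built with \<open>f0\<close> plus
      \<open>f 0\<close> times the sum of all b_j b_j^*. At the eigenvectors \<open>x i\<close> of
      the former its quadratic form is thus at least \<open>c0 i + f 0\<close>; Ky Fan's principle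
      then leads to the eigenvalues \<open>c\<close> of \<open>C\<close>.\<close>
    also have "\<dots> \<le> (\<Sum>i<k. \<Sum>a<n. c a * (cmod (cip n (y a) (x i)))\<^sup>2)"
    proof (rule sum_mono)
      fix i assume "i \<in> {..<k}"
      then have i: "i < n" using k by simp
      have "c0 i + f 0 \<le> (\<Sum>j<m * n. f0 (cmod (\<omega> j)) * (cmod (cip n (b j) (x i)))\<^sup>2)
          + f 0 * (\<Sum>j<m * n. (cmod (cip n (b j) (x i)))\<^sup>2)"
        using mult_left_mono[OF frame[OF orthonormal_sqn[OF x]], of i "f 0"] i f(2)[of 0]
          specf_real_quadratic_form(2)[OF x, of "m * n" b "\<lambda>j. f0 (cmod (\<omega> j))" c0 i] Cx by simp
      also have "\<dots> = (\<Sum>j<m * n. f (cmod (\<omega> j)) * (cmod (cip n (b j) (x i)))\<^sup>2)"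
        unfolding sum_distrib_left sum.distrib[symmetric] by (simp add: f0_def algebra_simps)
      also have "\<dots> = (\<Sum>a<n. c a * (cmod (cip n (y a) (x i)))\<^sup>2)"
        using specf_real_quadratic_form(1)[OF y, of "m * n" b "\<lambda>j. f (cmod (\<omega> j))" c "x i"] Cy by simp
      finally show "c0 i + f 0 \<le> (\<Sum>a<n. c a * (cmod (cip n (y a) (x i)))\<^sup>2)" .
    qed
    also have "\<dots> \<le> (\<Sum>i<k. c i)"
    proof (rule ky_fan_sum[OF y _ _ _ k])
      show "0 \<le> c a" if "a < n" for a
        using specf_real_quadratic_form(2)[OF y, of "m * n" b "\<lambda>j. f (cmod (\<omega> j))" c a] Cy f(2) that
        by (auto intro!: sum_nonneg)
      show "orthonormal n {..<k} x" by (rule orthonormal_subset[OF x]) (use k in auto)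
    qed (use c in auto)
    finally show ?thesis .
  qed
  have "N (mat_fun n f (mat_abs n X)) = N (real_diag n (\<lambda>i. f (\<sigma> i)))"
    unfolding absX mat_fun_spec_mat[OF v] by (rule symmetric_norm_spec_mat[OF assms(7) v])
  \<comment> \<open>Monotonicity of \<open>f\<close> keeps the values \<open>f (\<sigma> i)\<close>
    in decreasing order, as weak majorization requires.\<close>
  also have "\<dots> \<le> N (real_diag n c)"
    by (rule symmetric_norm_weak_majorization[OF assms(7)]) (use \<sigma> mono f(2) sums in auto)
  also have "\<dots> = N C"
    unfolding CN by (rule symmetric_norm_spec_mat[OF assms(7) y, symmetric])
  finally show ?thesis unfolding X_def C_def .
qed

end
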